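(* Let $V$ be a simple unitary vertex operator algebra which is exponentially energy-bounded, and let $U\subset V$ be an energy-bounded unitary subalgebra of $V$ such that $V$ (as a $U$-module via restriction of vertex operators) is a finite direct sum of simple $U$-modules. Then $V$ is energy-bounded.
   Context: A simple unitary vertex operator algebra is a vertex operator algebra $V$ (over $\mathbb{C}$) of CFT type, i.e. $V=\bigoplus_{n\geq 0}V_n$ with $V_n=\ker(L_0-n1_V)$ and $V_0=\mathbb{C}\Omega$, with vacuum $\Omega$ and conformal vector $\nu$, $Y(\nu,z)=\sum_{n}L_nz^{-n-2}$, equipped with a scalar product $(\cdot|\cdot)$ with $(\Omega|\Omega)=1$ and an antilinear involution $a\mapsto a^*$ with $\nu^*=\nu$ such that $(b|a_nc)=(a^*_{-n}b|c)$ for all $a,b,c\in V$, $n\in\mathbb{Z}$. For $a\in V$ the modes $a_n$ are defined by $Y(z^{L_0}a,z)=\sum_{n}a_nz^{-n}$. Write $\|a\|=\sqrt{(a|a)}$, $V_{\leq n}=\bigoplus_{k\leq n}V_k$, $\|R\|_n:=\sup\{\|Rb\|: b\in V_{\leq n},\|b\|\leq 1\}$ and $\|R\|:=\sup\{\|Rb\|:b\in V,\|b\|\leq1\}$, in $[0,+\infty]$. A vector $a$ satisfies energy bounds if there are real $s,C,t\geq0$ with $\|a_m\|_n\leq C(1+|m|)^t(1+|n|)^s$ for all $m,n\in\mathbb{Z}$; $V$ is energy-bounded if every $a\in V$ satisfies energy bounds; $V$ is exponentially energy-bounded if for every $a\in V$ there is $q>0$ with $\|a_0q^{L_0}\|<+\infty$.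 A unitary subalgebra of $V$ is a vertex subalgebra $U$ with $L_0U\subset U$ and $U^*=U$; it is energy-bounded if every $a\in U$ satisfies energy bounds. *)

theory Defs
  imports "HOL-Analysis.Analysis"
begin

text \<open>
A complex vector space is given by a type 'v of class ab_group_add together with a
scalar multiplication smul :: complex => 'v => 'v satisfying the vector_space locale.
Vertex operators are encoded by their standard modes:  Y a m b = a_(m) b, where
Y(a,z) = sum_m a_(m) z^(-m-1).
\<close>

type_synonym 'v vop = "'v \<Rightarrow> int \<Rightarrow> 'v \<Rightarrow> 'v"

definition Lmode :: "'v vop \<Rightarrow> 'v \<Rightarrow> int \<Rightarrow> 'v \<Rightarrow> 'v" where
  "Lmode Y cv n = Y cv (n + 1)"

definition Vgr :: "(complex \<Rightarrow> 'v::ab_group_add \<Rightarrow> 'v) \<Rightarrow> 'v vop \<Rightarrow> 'v \<Rightarrow> nat \<Rightarrow> 'v set" where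
  "Vgr smul Y cv n = {a. Lmode Y cv 0 a = smul (of_nat n) a}"

text \<open>Borcherds (Jacobi) identity; both sides are finite sums by truncation, so we
require equality of all sufficiently long partial sums.\<close>
definition borcherds :: "(complex \<Rightarrow> 'v::ab_group_add \<Rightarrow> 'v) \<Rightarrow> 'v vop \<Rightarrow> bool" where
  "borcherds smul Y \<longleftrightarrow> (\<forall>a b c p q r. \<exists>N. \<forall>M\<ge>N.
     (\<Sum>i<M. smul (of_int p gchoose i) (Y (Y a (r + int i) b) (p + q - int i) c))
   = (\<Sum>i<M. smul ((-1) ^ i * (of_int r gchoose i))
         (Y a (p + r - int i) (Y b (q + int i) c)
          - smul ((-1) powi r) (Y b (q + r - int i) (Y a (p + int i) c)))))"

definition is_VOA :: "(complex \<Rightarrow> 'v::ab_group_add \<Rightarrow> 'v) \<Rightarrow> 'v vop \<Rightarrow> 'v \<Rightarrow> 'v \<Rightarrow> bool" where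
  "is_VOA smul Y vac cv \<longleftrightarrow>
     vector_space smul
   \<and> (\<forall>a m. module_hom smul smul (Y a m))
   \<and> (\<forall>m b. module_hom smul smul (\<lambda>a. Y a m b))
   \<and> (\<forall>a b. \<exists>N::int. \<forall>m\<ge>N. Y a m b = 0)
   \<and> (\<forall>m b. Y vac m b = (if m = -1 then b else 0))
   \<and> (\<forall>a. Y a (-1) vac = a)
   \<and> (\<forall>a m. m \<ge> 0 \<longrightarrow> Y a m vac = 0)
   \<and> borcherds smul Y
   \<and> (\<exists>c::complex. \<forall>m n v.
        Lmode Y cv m (Lmode Y cv n v) - Lmode Y cv n (Lmode Y cv m v)
        = smul (of_int (m - n)) (Lmode Y cv (m + n) v)
          + (if m + n = 0 then smul (c / 12 * of_int (m ^ 3 - m)) v else 0))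
   \<and> (\<forall>a m b. Y (Lmode Y cv (-1) a) m b = smul (of_int (- m)) (Y a (m - 1) b))
   \<and> (\<forall>a. a \<in> module.span smul (\<Union>n. Vgr smul Y cv n))
   \<and> (\<forall>n. \<exists>B. finite B \<and> Vgr smul Y cv n \<subseteq> module.span smul B)
   \<and> Vgr smul Y cv 0 = module.span smul {vac}"

definition comp :: "(complex \<Rightarrow> 'v::ab_group_add \<Rightarrow> 'v) \<Rightarrow> 'v vop \<Rightarrow> 'v \<Rightarrow> nat \<Rightarrow> 'v \<Rightarrow> 'v" where
  "comp smul Y cv d a = (THE x. x \<in> Vgr smul Y cv d
      \<and> a - x \<in> module.span smul (\<Union>k\<in>- {d}. Vgr smul Y cv k))"

text \<open>Modes in the paper's convention: Y(z^{L_0} a, z) = sum_n a_n z^{-n};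
for a in V_d, a_n = a_(n+d-1); extended linearly.\<close>
definition pmode :: "(complex \<Rightarrow> 'v::ab_group_add \<Rightarrow> 'v) \<Rightarrow> 'v vop \<Rightarrow> 'v \<Rightarrow> 'v \<Rightarrow> int \<Rightarrow> 'v \<Rightarrow> 'v" where
  "pmode smul Y cv a n b =
     (\<Sum>d\<in>{d. comp smul Y cv d a \<noteq> 0}. Y (comp smul Y cv d a) (n + int d - 1) b)"

definition vnorm :: "('v \<Rightarrow> 'v \<Rightarrow> complex) \<Rightarrow> 'v \<Rightarrow> real" where
  "vnorm sp a = sqrt (Re (sp a a))"

definition is_unitary_VOA ::
  "(complex \<Rightarrow> 'v::ab_group_add \<Rightarrow> 'v) \<Rightarrow> 'v vop \<Rightarrow> 'v \<Rightarrow> 'v \<Rightarrow> ('v \<Rightarrow> 'v \<Rightarrow> complex) \<Rightarrow> ('v \<Rightarrow> 'v) \<Rightarrow> bool" where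
  "is_unitary_VOA smul Y vac cv sp star \<longleftrightarrow>
     is_VOA smul Y vac cv
   \<comment> \<open>scalar product: linear in the first, antilinear in the second variable\<close>
   \<and> (\<forall>a b c x. sp (smul x a + b) c = x * sp a c + sp b c)
   \<and> (\<forall>a b. sp b a = cnj (sp a b))
   \<and> (\<forall>a. a \<noteq> 0 \<longrightarrow> Re (sp a a) > 0)
   \<and> sp vac vac = 1
   \<comment> \<open>antilinear involution\<close>
   \<and> (\<forall>a b x. star (smul x a + b) = smul (cnj x) (star a) + star b)
   \<and> (\<forall>a. star (star a) = a)
   \<and> star cv = cv
   \<and> (\<forall>a b c n. sp b (pmode smul Y cv a n c) = sp (pmode smul Y cv (star a) (- n) b) c)"

definition is_ideal :: "(complex \<Rightarrow> 'v::ab_group_add \<Rightarrow> 'v) \<Rightarrow> 'v vop \<Rightarrow> 'v set \<Rightarrow> bool" where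
  "is_ideal smul Y I \<longleftrightarrow> module.subspace smul I
     \<and> (\<forall>a x m. x \<in> I \<longrightarrow> Y a m x \<in> I \<and> Y x m a \<in> I)"

definition is_simple_VA :: "(complex \<Rightarrow> 'v::ab_group_add \<Rightarrow> 'v) \<Rightarrow> 'v vop \<Rightarrow> bool" where
  "is_simple_VA smul Y \<longleftrightarrow> (\<exists>v::'v. v \<noteq> 0)
     \<and> (\<forall>I. is_ideal smul Y I \<longrightarrow> I = {0} \<or> I = UNIV)"

definition simple_unitary_VOA ::
  "(complex \<Rightarrow> 'v::ab_group_add \<Rightarrow> 'v) \<Rightarrow> 'v vop \<Rightarrow> 'v \<Rightarrow> 'v \<Rightarrow> ('v \<Rightarrow> 'v \<Rightarrow> complex) \<Rightarrow> ('v \<Rightarrow> 'v) \<Rightarrow> bool" where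
  "simple_unitary_VOA smul Y vac cv sp star \<longleftrightarrow>
     is_unitary_VOA smul Y vac cv sp star \<and> is_simple_VA smul Y"

text \<open>V_{<= n} (for integer n; empty sum gives {0} when n < 0).\<close>
definition Vle :: "(complex \<Rightarrow> 'v::ab_group_add \<Rightarrow> 'v) \<Rightarrow> 'v vop \<Rightarrow> 'v \<Rightarrow> int \<Rightarrow> 'v set" where
  "Vle smul Y cv n = module.span smul (\<Union>k\<in>{k::nat. int k \<le> n}. Vgr smul Y cv k)"

definition opnorm_n :: "(complex \<Rightarrow> 'v::ab_group_add \<Rightarrow> 'v) \<Rightarrow> 'v vop \<Rightarrow> 'v \<Rightarrow> ('v \<Rightarrow> 'v \<Rightarrow> complex)
    \<Rightarrow> ('v \<Rightarrow> 'v) \<Rightarrow> int \<Rightarrow> ennreal" where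
  "opnorm_n smul Y cv sp R n =
     (SUP b\<in>{b. b \<in> Vle smul Y cv n \<and> vnorm sp b \<le> 1}. ennreal (vnorm sp (R b)))"

definition opnorm :: "('v \<Rightarrow> 'v \<Rightarrow> complex) \<Rightarrow> ('v \<Rightarrow> 'v) \<Rightarrow> ennreal" where
  "opnorm sp R = (SUP b\<in>{b. vnorm sp b \<le> 1}. ennreal (vnorm sp (R b)))"

definition energy_bounds :: "(complex \<Rightarrow> 'v::ab_group_add \<Rightarrow> 'v) \<Rightarrow> 'v vop \<Rightarrow> 'v
    \<Rightarrow> ('v \<Rightarrow> 'v \<Rightarrow> complex) \<Rightarrow> 'v \<Rightarrow> bool" where
  "energy_bounds smul Y cv sp a \<longleftrightarrow> (\<exists>s C t::real. s \<ge> 0 \<and> C \<ge> 0 \<and> t \<ge> 0 \<and>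
     (\<forall>m n::int. opnorm_n smul Y cv sp (pmode smul Y cv a m) n
        \<le> ennreal (C * (1 + real_of_int \<bar>m\<bar>) powr t * (1 + real_of_int \<bar>n\<bar>) powr s)))"

definition qL0 :: "(complex \<Rightarrow> 'v::ab_group_add \<Rightarrow> 'v) \<Rightarrow> 'v vop \<Rightarrow> 'v \<Rightarrow> real \<Rightarrow> 'v \<Rightarrow> 'v" where
  "qL0 smul Y cv q b =
     (\<Sum>d\<in>{d. comp smul Y cv d b \<noteq> 0}. smul (complex_of_real (q ^ d)) (comp smul Y cv d b))"

definition exp_energy_bounded :: "(complex \<Rightarrow> 'v::ab_group_add \<Rightarrow> 'v) \<Rightarrow> 'v vop \<Rightarrow> 'v
    \<Rightarrow> ('v \<Rightarrow> 'v \<Rightarrow> complex) \<Rightarrow> bool" where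
  "exp_energy_bounded smul Y cv sp \<longleftrightarrow> (\<forall>a. \<exists>q::real. q > 0 \<and>
     opnorm sp (\<lambda>b. pmode smul Y cv a 0 (qL0 smul Y cv q b)) < \<infinity>)"

definition unitary_subalgebra :: "(complex \<Rightarrow> 'v::ab_group_add \<Rightarrow> 'v) \<Rightarrow> 'v vop \<Rightarrow> 'v \<Rightarrow> 'v
    \<Rightarrow> ('v \<Rightarrow> 'v) \<Rightarrow> 'v set \<Rightarrow> bool" where
  "unitary_subalgebra smul Y vac cv star U \<longleftrightarrow>
     module.subspace smul U \<and> vac \<in> U
   \<and> (\<forall>a\<in>U. \<forall>b\<in>U. \<forall>m. Y a m b \<in> U)
   \<and> Lmode Y cv 0 ` U \<subseteq> U
   \<and> star ` U = U"

definition U_submodule :: "(complex \<Rightarrow> 'v::ab_group_add \<Rightarrow> 'v) \<Rightarrow> 'v vop \<Rightarrow> 'v set \<Rightarrow> 'v set \<Rightarrow> bool" where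
  "U_submodule smul Y U M \<longleftrightarrow> module.subspace smul M
     \<and> (\<forall>a\<in>U. \<forall>x\<in>M. \<forall>m. Y a m x \<in> M)"

definition simple_U_submodule :: "(complex \<Rightarrow> 'v::ab_group_add \<Rightarrow> 'v) \<Rightarrow> 'v vop \<Rightarrow> 'v set \<Rightarrow> 'v set \<Rightarrow> bool" where
  "simple_U_submodule smul Y U M \<longleftrightarrow> U_submodule smul Y U M \<and> M \<noteq> {0}
     \<and> (\<forall>N. U_submodule smul Y U N \<and> N \<subseteq> M \<longrightarrow> N = {0} \<or> N = M)"

definition finite_sum_simple_U_modules :: "(complex \<Rightarrow> 'v::ab_group_add \<Rightarrow> 'v) \<Rightarrow> 'v vop \<Rightarrow> 'v set \<Rightarrow> bool" where
  "finite_sum_simple_U_modules smul Y U \<longleftrightarrow> (\<exists>(k::nat) (M::nat \<Rightarrow> 'v set).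
     (\<forall>i<k. simple_U_submodule smul Y U (M i))
   \<and> (\<forall>v. \<exists>!x::nat \<Rightarrow> 'v. (\<forall>i<k. x i \<in> M i) \<and> (\<forall>i\<ge>k. x i = 0) \<and> v = (\<Sum>i<k. x i)))"

end

theory Submission
  imports Defs "HOL-Real_Asymp.Real_Asymp"
begin

text \<open>
Write \<open>\<parallel>R\<parallel>\<^sub>n\<close> for the norm of \<open>R\<close> on vectors of energy at most \<open>n\<close>. For \<open>m \<ge> 1\<close>, the square norms of
\<open>a\<^sub>-\<^sub>m c\<close> and of \<open>a\<^sup>*\<^sub>m c\<close> differ by \<open>(c|[a\<^sup>*\<^sub>m, a\<^sub>-\<^sub>m]c)\<close>, and the commutator is a combination, with
coefficients polynomial in \<open>m\<close>, of the zero modes of finitely many vectors. As \<open>a\<^sup>*\<^sub>m\<close> on energy \<open>n\<close> is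
adjoint to \<open>a\<^sub>-\<^sub>m\<close> on energy \<open>n - m\<close>, iterating bounds \<open>\<parallel>a\<^sub>m\<parallel>\<^sub>n\<close> for \<open>m \<noteq> 0\<close>, up to polynomial factors, by
the square root of the norms of these zero modes; \<open>a\<^sub>0\<close> follows from \<open>d a\<^sub>0 = [L\<^sub>1, a\<^sub>-\<^sub>1] - (L\<^sub>1 a)\<^sub>0\<close>.

Conversely, a bound on finitely many vectors which generate \<open>V\<close> as a \<open>U\<close>-module propagates, up to
polynomial factors, to all of \<open>V\<close>. So there is a finite set of zero modes whose maximal norm \<open>Z n\<close>
satisfies \<open>Z n \<le> C (1 + n)\<^sup>s sqrt (Z (n + c))\<close>. Since \<open>Z\<close> grows at most exponentially, iterating
this inequality shows that \<open>Z\<close> is bounded by a polynomial.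
\<close>

section \<open>Elementary estimates\<close>

text \<open>Each factor of the falling factorial has norm at most \<open>norm x + j\<close>, and
  \<open>fact j\<close> is discarded. For fixed \<open>j\<close> the bound is polynomial in
  \<open>x\<close>, as needed in the commutator formula, where only the upper entry varies with the
  mode.\<close>

lemma gbinomial_norm_le: "norm ((x::complex) gchoose j) \<le> (norm x + real j) ^ j"
proof -
  have "norm (\<Prod>i = 0..<j. x - of_nat i) \<le> (\<Prod>i = 0..<j. norm x + real j)"
    unfolding prod_norm[symmetric]
  proof (rule prod_mono)
    fix i assume "i \<in> {0..<j}"
    then show "0 \<le> norm (x - of_nat i) \<and> norm (x - of_nat i) \<le> norm x + real j"
      using norm_triangle_ineq4[of x "of_nat i"] by auto
  qed
  then have "norm (\<Prod>i = 0..<j. x - of_nat i) \<le> (norm x + real j) ^ j" by simp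
  moreover have "norm (x gchoose j) \<le> norm (\<Prod>i = 0..<j. x - of_nat i)"
  proof -
    have "norm (x gchoose j) = norm (\<Prod>i = 0..<j. x - of_nat i) / fact j"
      unfolding gbinomial_prod_rev norm_divide norm_fact ..
    also have "\<dots> \<le> norm (\<Prod>i = 0..<j. x - of_nat i)"
      by (simp add: divide_le_eq mult_le_cancel_left1 fact_ge_1)
    finally show ?thesis .
  qed
  ultimately show ?thesis by linarith
qed

text \<open>The opposite regime, for the associator formula: the upper entry is fixed and
  \<open>i\<close> varies. For \<open>k \<ge> 0\<close> the coefficients are bounded; for
  \<open>k = - (r + 1)\<close> negating the upper entry gives \<open>r + i choose r\<close>, of
  degree \<open>r\<close> in \<open>i\<close>.\<close>

lemma gbinomial_int_norm_le:
  obtains K where "K \<ge> 0" "\<And>i. norm ((of_int k :: complex) gchoose i) \<le> K * (1 + real i) ^ nat \<bar>k\<bar>"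
proof (cases "k \<ge> 0")
  case True
  then obtain r where k: "k = int r" by (metis nonneg_int_cases)
  have "norm ((of_int k :: complex) gchoose i) \<le> 2 ^ r * (1 + real i) ^ nat \<bar>k\<bar>" for i
  proof -
    have "norm ((of_int k :: complex) gchoose i) = real (r choose i)"
      by (simp add: k binomial_gbinomial[symmetric])
    also have "\<dots> \<le> 2 ^ r"
      using binomial_le_pow2[of r i] by (metis of_nat_le_iff of_nat_numeral of_nat_power)
    also have "\<dots> \<le> 2 ^ r * (1 + real i) ^ nat \<bar>k\<bar>" by simp
    finally show ?thesis .
  qed
  then show ?thesis by (rule that[rotated]) simp
next
  case False
  then obtain r where k: "k = - int (Suc r)" by (metis negative_eq_positive not_le_imp_less int_cases2 negD)
  have "norm ((of_int k :: complex) gchoose i) \<le> real (Suc r) ^ r * (1 + real i) ^ nat \<bar>k\<bar>" for i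
  proof -
    have "(of_int k :: complex) gchoose i = (- 1) ^ i * ((of_nat (r + i)) gchoose i)"
      using gbinomial_minus[of "of_nat (Suc r) :: complex" i] by (simp add: k algebra_simps)
    then have "norm ((of_int k :: complex) gchoose i) = norm ((- 1) ^ i * of_nat (r + i choose i) :: complex)"
      by (simp only: binomial_gbinomial)
    also have "\<dots> = real (r + i choose i)"
      unfolding norm_mult norm_power norm_of_nat by simp
    also have "\<dots> = real (r + i choose r)" using binomial_symmetric[of i "r + i"] by simp
    also have "\<dots> \<le> real (r + i) ^ r"
      using binomial_le_pow[of r "r + i"] by (metis le_add1 of_nat_le_iff of_nat_power)
    also have "\<dots> \<le> (real (Suc r) * (1 + real i)) ^ r"
      by (intro power_mono) (simp_all add: algebra_simps)
    also have "\<dots> \<le> real (Suc r) ^ r * (1 + real i) ^ nat \<bar>k\<bar>"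
      unfolding power_mult_distrib by (intro mult_left_mono power_increasing) (auto simp: k)
    finally show ?thesis .
  qed
  then show ?thesis by (rule that[rotated]) simp
qed

section \<open>Growth functions and a self-improving inequality\<close>

text \<open>The comparison functions of all later bounds. The class is closed under square roots,
  and the lower bound \<open>1\<close> lets an estimate without such a factor be weakened to one
  with it.\<close>

definition growth :: "(nat \<Rightarrow> real) \<Rightarrow> bool" where
  "growth g \<longleftrightarrow> mono g \<and> (\<forall>n. g n \<ge> 1)"

lemma growth_mono: "growth g \<Longrightarrow> m \<le> n \<Longrightarrow> g m \<le> g n"
  and growth_ge1: "growth g \<Longrightarrow> g n \<ge> 1"
  by (auto simp: growth_def mono_def)

lemma growth_ge0: "growth g \<Longrightarrow> g n \<ge> 0"
  using growth_ge1[of g n] by simp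

lemma growth_sqrt: "growth g \<Longrightarrow> growth (\<lambda>n. sqrt (g n))"
  by (auto simp: growth_def mono_def)

lemma growth_one: "growth (\<lambda>_. 1)"
  by (auto simp: growth_def mono_def)

text \<open>Dividing \<open>Z\<close> by a suitable multiple of \<open>(1 + n) ^ (2 * s)\<close> gives \<open>h\<close> with
\<open>h n \<le> sqrt (h (n + c))\<close>; iterating, \<open>h n ^ 2 ^ k \<le> h (n + k * c)\<close>, and \<open>h n > 1\<close> would force
doubly exponential growth.\<close>
lemma self_improving_bound:
  fixes Z :: "nat \<Rightarrow> real"
  assumes Z: "\<And>n. Z n \<ge> 1" and C: "C \<ge> 0"
    and sqrt_le: "\<And>n. Z n \<le> C * (1 + real n) ^ s * sqrt (Z (n + c))"
    and exp_le: "\<And>n. Z n \<le> K * R ^ n" and R: "R \<ge> 1"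
  shows "\<exists>C' s'. C' \<ge> 0 \<and> (\<forall>n. Z n \<le> C' * (1 + real n) ^ s')"
proof -
  \<comment> \<open>\<open>sqrt D\<close> has to exceed \<open>C * (1 + c) ^ s\<close>, the cost of
    replacing \<open>1 + n + c\<close> by \<open>(1 + c) * (1 + n)\<close> under the power; the
    summand \<open>1\<close> gives \<open>D \<ge> 1\<close> even for \<open>C = 0\<close>.\<close>
  define D where "D = (C * (1 + real c) ^ s + 1)\<^sup>2"
  define h where "h n = Z n / (D * (1 + real n) ^ (2 * s))" for n
  have sD: "sqrt D = C * (1 + real c) ^ s + 1" using C by (simp add: D_def)
  have D1: "D \<ge> 1" using C by (simp add: D_def)
  have Z_h: "Z n = h n * (D * (1 + real n) ^ (2 * s))" for n
    using D1 by (simp add: h_def add_nonneg_eq_0_iff)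
  have h_pos: "h n > 0" for n
    unfolding h_def using Z[of n] D1 by (intro divide_pos_pos mult_pos_pos zero_less_power) auto
  have h_sq: "(h n)\<^sup>2 \<le> h (n + c)" for n
  proof -
    define p where "p = (1 + real n) ^ s"
    have p: "p > 0" by (simp add: p_def)
    have "(1 + real (n + c)) ^ s \<le> ((1 + real c) * (1 + real n)) ^ s"
      by (intro power_mono) (auto simp: algebra_simps)
    then have le: "(1 + real (n + c)) ^ s \<le> (1 + real c) ^ s * p"
      by (simp add: power_mult_distrib p_def)
    have "h n * (D * p\<^sup>2) = Z n" by (simp add: Z_h p_def power_mult[symmetric] mult.commute)
    also have "\<dots> \<le> C * p * sqrt (Z (n + c))" using sqrt_le[of n] by (simp add: p_def)
    also have "sqrt (Z (n + c)) = sqrt (h (n + c)) * sqrt D * (1 + real (n + c)) ^ s"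
    proof -
      have "Z (n + c) = h (n + c) * D * ((1 + real (n + c)) ^ s)\<^sup>2"
        by (simp add: Z_h[of "n + c"] power_mult[symmetric] mult_ac)
      then show ?thesis by (simp add: real_sqrt_mult)
    qed
    also have "C * p * (sqrt (h (n + c)) * sqrt D * (1 + real (n + c)) ^ s)
        \<le> C * p * (sqrt (h (n + c)) * sqrt D * ((1 + real c) ^ s * p))"
      using C p h_pos[of "n + c"] D1 by (intro mult_left_mono le) auto
    also have "\<dots> = (C * (1 + real c) ^ s) * (sqrt D * p\<^sup>2 * sqrt (h (n + c)))"
      by (simp add: power2_eq_square mult_ac)
    also have "\<dots> \<le> sqrt D * (sqrt D * p\<^sup>2 * sqrt (h (n + c)))"
    proof (rule mult_right_mono)
      show "C * (1 + real c) ^ s \<le> sqrt D" unfolding sD by simp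
      show "0 \<le> sqrt D * p\<^sup>2 * sqrt (h (n + c))" using D1 h_pos[of "n + c"] by simp
    qed
    also have "\<dots> = sqrt (h (n + c)) * (D * p\<^sup>2)"
      using D1 by (simp add: mult_ac) 
    finally have "h n \<le> sqrt (h (n + c))" using p D1 by simp
    then have "(h n)\<^sup>2 \<le> (sqrt (h (n + c)))\<^sup>2" using h_pos[of n] by (intro power_mono) auto
    then show ?thesis using h_pos[of "n + c"] by simp
  qed
  have iter: "h n ^ (2 ^ k) \<le> h (n + k * c)" for n k
  proof (induction k)
    case (Suc k)
    have "h n ^ (2 ^ Suc k) = (h n ^ (2 ^ k))\<^sup>2" by (simp add: mult.commute flip: power_mult)
    also have "\<dots> \<le> (h (n + k * c))\<^sup>2" using Suc h_pos[of n] by (intro power_mono) auto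
    also have "\<dots> \<le> h (n + k * c + c)" by (rule h_sq)
    finally show ?case by (simp add: algebra_simps)
  qed simp
  have "h n \<le> 1" for n
  proof (rule ccontr)
    assume "\<not> h n \<le> 1"
    then have h1: "h n > 1" by simp
    have K: "K > 0" using Z[of 0] exp_le[of 0] by simp
    have le: "2 ^ k * ln (h n) \<le> ln K + real (n + k * c) * ln R" for k :: nat
    proof -
      have "h n ^ (2 ^ k) \<le> h (n + k * c)" by (rule iter)
      also have "\<dots> \<le> Z (n + k * c)"
      proof -
        have "1 * 1 \<le> D * (1 + real (n + k * c)) ^ (2 * s)"
          using D1 by (intro mult_mono one_le_power) auto
        then show ?thesis
          unfolding Z_h[of "n + k * c"] using mult_left_mono[OF _ less_imp_le[OF h_pos]] by fastforce
      qed
      also have "\<dots> \<le> K * R ^ (n + k * c)" by (rule exp_le)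
      finally have "ln (h n ^ (2 ^ k)) \<le> ln (K * R ^ (n + k * c))"
        using h1 by (intro ln_mono) auto
      then show ?thesis using h1 K R by (simp add: ln_realpow ln_mult)
    qed
    have l: "ln (h n) > 0" using h1 by simp
    have "eventually (\<lambda>k::nat. 2 ^ k * ln (h n) > ln K + real (n + k * c) * ln R) sequentially"
      using l by real_asymp
    then show False using le by (auto simp: eventually_sequentially) (meson le_refl not_le)
  qed
  then have "Z n \<le> D * (1 + real n) ^ (2 * s)" for n
    unfolding Z_h[of n] using D1 by (simp add: mult_left_le_one_le h_pos less_imp_le)
  then show ?thesis using D1 by (intro exI[of _ D] exI[of _ "2 * s"]) simp
qed

section \<open>Unitary vertex operator algebras\<close>

locale uVOA =
  fixes smul :: "complex \<Rightarrow> 'v::ab_group_add \<Rightarrow> 'v"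
    and Y :: "'v vop"
    and vac cv :: 'v
    and sp :: "'v \<Rightarrow> 'v \<Rightarrow> complex"
    and star :: "'v \<Rightarrow> 'v"
  assumes unitary: "is_unitary_VOA smul Y vac cv sp star"
begin

section \<open>Linearity, commutator and associator formulas\<close>

lemma VOA: "is_VOA smul Y vac cv"
  using unitary by (simp add: is_unitary_VOA_def)

sublocale vector_space smul
  using VOA by (simp add: is_VOA_def)

lemma Y_hom: "module_hom smul smul (Y a m)" "module_hom smul smul (\<lambda>a. Y a m b)"
  using VOA by (auto simp: is_VOA_def)

lemmas Y_add = module_hom.add[OF Y_hom(1)] and Y_scale = module_hom.scale[OF Y_hom(1)]
  and Y_diff = module_hom.diff[OF Y_hom(1)] and Y_sum = module_hom.sum[OF Y_hom(1)]
  and Y_zero = module_hom.zero[OF Y_hom(1)]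
  and Y_add_left = module_hom.add[OF Y_hom(2)] and Y_scale_left = module_hom.scale[OF Y_hom(2)]
  and Y_sum_left = module_hom.sum[OF Y_hom(2)]
  and Y_zero_left = module_hom.zero[OF Y_hom(2)]

lemma Y_truncation: "\<exists>N::int. \<forall>m\<ge>N. Y a m b = 0"
  using VOA by (simp add: is_VOA_def)

text \<open>The Borcherds identity at \<open>r = 0\<close>, where \<open>r gchoose i\<close> leaves
  only \<open>i = 0\<close> on the right. The cutoff \<open>J\<close> depends on \<open>a\<close>
  and \<open>b\<close> alone, so the same finitely many vectors \<open>Y a i b\<close> serve for all
  \<open>p\<close>, \<open>q\<close> and \<open>c\<close>.\<close>

lemma Y_commutator:
  assumes J: "\<And>i. i \<ge> J \<Longrightarrow> Y a (int i) b = 0"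
  shows "Y a p (Y b q c) - Y b q (Y a p c)
    = (\<Sum>i<J. smul (of_int p gchoose i) (Y (Y a (int i) b) (p + q - int i) c))"
proof -
  have "borcherds smul Y" using VOA by (simp add: is_VOA_def)
  then obtain N where N: "\<And>M. M \<ge> N \<Longrightarrow>
     (\<Sum>i<M. smul (of_int p gchoose i) (Y (Y a (0 + int i) b) (p + q - int i) c))
   = (\<Sum>i<M. smul ((-1) ^ i * (of_int 0 gchoose i))
         (Y a (p + 0 - int i) (Y b (q + int i) c)
          - smul ((-1) powi 0) (Y b (q + 0 - int i) (Y a (p + int i) c))))"
    unfolding borcherds_def by meson
  define M where "M = max N (Suc J)"
  have "(\<Sum>i<M. smul (of_int p gchoose i) (Y (Y a (0 + int i) b) (p + q - int i) c))
      = (\<Sum>i<J. smul (of_int p gchoose i) (Y (Y a (int i) b) (p + q - int i) c))"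
    by (rule sum.mono_neutral_cong_right) (auto simp: M_def J Y_zero_left)
  moreover have "(\<Sum>i<M. smul ((-1) ^ i * (of_int 0 gchoose i))
         (Y a (p + 0 - int i) (Y b (q + int i) c)
          - smul ((-1) powi 0) (Y b (q + 0 - int i) (Y a (p + int i) c))))
      = (\<Sum>i\<in>{0}. smul ((-1) ^ i * (of_int 0 gchoose i))
         (Y a (p + 0 - int i) (Y b (q + int i) c)
          - smul ((-1) powi 0) (Y b (q + 0 - int i) (Y a (p + int i) c))))"
  proof (rule sum.mono_neutral_right)
    show "\<forall>i\<in>{..<M} - {0}. smul ((-1) ^ i * (of_int 0 gchoose i))
         (Y a (p + 0 - int i) (Y b (q + int i) c)
          - smul ((-1) powi 0) (Y b (q + 0 - int i) (Y a (p + int i) c))) = 0"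
    proof
      fix i assume "i \<in> {..<M} - {0}"
      then obtain i' where "i = Suc i'" by (cases i) auto
      then have "of_int 0 gchoose i = (0::complex)" by (simp add: gbinomial_0)
      then show "smul ((-1) ^ i * (of_int 0 gchoose i))
         (Y a (p + 0 - int i) (Y b (q + int i) c)
          - smul ((-1) powi 0) (Y b (q + 0 - int i) (Y a (p + int i) c))) = 0" by simp
    qed
  qed (auto simp: M_def)
  ultimately show ?thesis using N[of M] by (simp add: M_def)
qed

text \<open>The Borcherds identity at \<open>p = 0\<close>, where the left side reduces to its first
  term. Here the cutoff \<open>N\<close> depends on all arguments; an explicit one comes later from
  the grading.\<close>

lemma Y_associator:
  "\<exists>N. \<forall>M\<ge>N. Y (Y a k b) q c = (\<Sum>i<M. smul ((-1) ^ i * (of_int k gchoose i))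
      (Y a (k - int i) (Y b (q + int i) c)
       - smul ((-1) powi k) (Y b (q + k - int i) (Y a (int i) c))))"
proof -
  have "borcherds smul Y" using VOA by (simp add: is_VOA_def)
  then obtain N where N: "\<And>M. M \<ge> N \<Longrightarrow>
     (\<Sum>i<M. smul (of_int 0 gchoose i) (Y (Y a (k + int i) b) (0 + q - int i) c))
   = (\<Sum>i<M. smul ((-1) ^ i * (of_int k gchoose i))
         (Y a (0 + k - int i) (Y b (q + int i) c)
          - smul ((-1) powi k) (Y b (q + k - int i) (Y a (0 + int i) c))))"
    unfolding borcherds_def by meson
  have eq: "(\<Sum>i<M. smul (of_int 0 gchoose i) (Y (Y a (k + int i) b) (0 + q - int i) c))
      = (\<Sum>i\<in>{0}. smul (of_int 0 gchoose i) (Y (Y a (k + int i) b) (0 + q - int i) c))"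
    if "M \<ge> Suc N" for M
  proof (rule sum.mono_neutral_right)
    show "\<forall>i\<in>{..<M} - {0}. smul (of_int 0 gchoose i) (Y (Y a (k + int i) b) (0 + q - int i) c) = 0"
    proof
      fix i assume "i \<in> {..<M} - {0}"
      then obtain i' where "i = Suc i'" by (cases i) auto
      then have "of_int 0 gchoose i = (0::complex)" by (simp add: gbinomial_0)
      then show "smul (of_int 0 gchoose i) (Y (Y a (k + int i) b) (0 + q - int i) c) = 0" by simp
    qed
  qed (use that in auto)
  show ?thesis
  proof (intro exI allI impI)
    fix M assume "M \<ge> Suc N"
    then show "Y (Y a k b) q c = (\<Sum>i<M. smul ((-1) ^ i * (of_int k gchoose i))
      (Y a (k - int i) (Y b (q + int i) c)
       - smul ((-1) powi k) (Y b (q + k - int i) (Y a (int i) c))))"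
      using eq[of M] N[of M] by simp
  qed
qed

abbreviation "L \<equiv> Lmode Y cv"

lemma L_deriv: "Y (L (-1) a) m b = smul (of_int (- m)) (Y a (m - 1) b)"
  using VOA unfolding is_VOA_def by blast

subsection \<open>The conformal grading\<close>

text \<open>Indexing the grading by integers makes the grading rule for modes unconditional; the
negative part vanishes.\<close>
definition Gz :: "int \<Rightarrow> 'v set" where
  "Gz k = {a. L 0 a = smul (of_int k) a}"

lemma Vgr_eq: "Vgr smul Y cv n = Gz (int n)"
  by (simp add: Vgr_def Gz_def)

lemma L_linear: "L k (a + b) = L k a + L k b" "L k (smul x a) = smul x (L k a)"
  "L k (a - b) = L k a - L k b" "L k (sum f I) = (\<Sum>i\<in>I. L k (f i))" "L k 0 = 0"
  by (simp_all add: Lmode_def Y_add Y_scale Y_diff Y_sum Y_zero)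

lemma subspace_Gz: "subspace (Gz k)"
  unfolding subspace_def Gz_def
  by (auto simp: L_linear scale_right_distrib scale_left_commute)

lemma zero_in_Gz [simp]: "0 \<in> Gz k"
  using subspace_0[OF subspace_Gz] .

text \<open>Applying \<open>L 0 - j\<close> stays in \<open>W\<close>, kills the component of degree
  \<open>j\<close> and multiplies the others by nonzero factors \<open>i - j\<close>; induction
  recovers those, and the component of degree \<open>j\<close> is the difference.
  \<open>W = {0}\<close> gives independence of the eigenspaces, \<open>W = U\<close> the grading of
  the subalgebra.\<close>

lemma eigen_components:
  assumes "subspace W" "\<And>x. x \<in> W \<Longrightarrow> L 0 x \<in> W" "finite I"
  shows "(\<And>i. i \<in> I \<Longrightarrow> f i \<in> Gz i) \<Longrightarrow> (\<Sum>i\<in>I. f i) \<in> W \<Longrightarrow> i \<in> I \<Longrightarrow> f i \<in> W"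
  using assms(3)
proof (induction I arbitrary: f i rule: finite_induct)
  case empty
  then show ?case by simp
next
  case (insert j I)
  define s where "s = (\<Sum>i\<in>insert j I. f i)"
  have s: "s \<in> W" "s = f j + (\<Sum>i\<in>I. f i)"
    using insert by (auto simp: s_def)
  have "L 0 s - smul (of_int j) s \<in> W"
    using s assms by (simp add: subspace_diff subspace_scale)
  also have "L 0 s - smul (of_int j) s = (\<Sum>i\<in>I. smul (of_int (i - j)) (f i))"
  proof -
    have "L 0 s = (\<Sum>i\<in>insert j I. smul (of_int i) (f i))"
      unfolding s_def L_linear using insert.prems(1) by (intro sum.cong) (auto simp: Gz_def)
    then have "L 0 s - smul (of_int j) s = (\<Sum>i\<in>insert j I. smul (of_int (i - j)) (f i))"
      by (simp add: s_def scale_sum_right sum_subtractf scale_left_diff_distrib)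
    then show ?thesis using insert by simp
  qed
  finally have 1: "(\<Sum>i\<in>I. smul (of_int (i - j)) (f i)) \<in> W" .
  have I: "f i \<in> W" if "i \<in> I" for i
  proof -
    have "smul (of_int (i - j)) (f i) \<in> W"
    proof (rule insert.IH[OF _ 1 that])
      fix i assume "i \<in> I"
      then show "smul (of_int (i - j)) (f i) \<in> Gz i"
        using insert.prems(1) subspace_scale[OF subspace_Gz] by simp
    qed
    then have "smul (1 / of_int (i - j)) (smul (of_int (i - j)) (f i)) \<in> W"
      using assms subspace_scale by blast
    moreover have "i \<noteq> j" using that insert by auto
    ultimately show ?thesis by simp
  qed
  have "s - (\<Sum>i\<in>I. f i) \<in> W"
    using s(1) I assms(1) by (intro subspace_diff subspace_sum)
  then have "f j \<in> W" using s(2) by simp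
  then show ?case using I insert.prems by auto
qed

text \<open>The family \<open>f\<close> is defined in all degrees and vanishes off a finite set, so
  that it can be identified with the family of components \<open>cmp\<close>.\<close>

lemma span_graded:
  assumes "x \<in> span (\<Union>k\<in>K. Vgr smul Y cv k)"
  shows "\<exists>I f. finite I \<and> I \<subseteq> K \<and> (\<forall>k. f k \<in> Vgr smul Y cv k) \<and> (\<forall>k. k \<notin> I \<longrightarrow> f k = 0)
    \<and> x = (\<Sum>k\<in>I. f k)"
  using assms
proof (induction rule: span_induct_alt)
  case base
  show ?case by (intro exI[of _ "{}"] exI[of _ "\<lambda>_. 0"]) (auto simp: Vgr_eq)
next
  case (step c y z)
  from step(2) obtain I f where f: "finite I" "I \<subseteq> K" "\<And>k. f k \<in> Vgr smul Y cv k"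
    "\<And>k. k \<notin> I \<Longrightarrow> f k = 0" "z = (\<Sum>k\<in>I. f k)" by auto
  from step(1) obtain k where k: "k \<in> K" "y \<in> Vgr smul Y cv k" by auto
  define f' where "f' = f(k := f k + smul c y)"
  have "(\<Sum>i\<in>insert k I. f' i) = f' k + (\<Sum>i\<in>I - {k}. f' i)"
    using f by (simp add: sum.insert_remove)
  also have "(\<Sum>i\<in>I - {k}. f' i) = (\<Sum>i\<in>I - {k}. f i)" by (simp add: f'_def)
  also have "f' k + \<dots> = smul c y + (\<Sum>i\<in>insert k I. f i)"
    using f by (simp add: sum.insert_remove f'_def)
  also have "(\<Sum>i\<in>insert k I. f i) = z"
    unfolding f(5) by (rule sum.mono_neutral_right) (use f in auto)
  finally have "smul c y + z = (\<Sum>i\<in>insert k I. f' i)" by simp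
  then show ?case using f k
    by (intro exI[of _ "insert k I"] exI[of _ f'])
      (auto simp: f'_def Vgr_eq intro!: subspace_add[OF subspace_Gz] subspace_scale[OF subspace_Gz])
qed

section \<open>Homogeneous components\<close>

abbreviation "cmp \<equiv> comp smul Y cv"

lemma independent_graded:
  assumes "finite I" "\<And>i. i \<in> I \<Longrightarrow> f i \<in> Gz i" "(\<Sum>i\<in>I. f i) = 0" "i \<in> I"
  shows "f i = 0"
  using eigen_components[of "{0}" I f i] assms by (auto simp: L_linear)

lemma sum_int_image: "(\<Sum>k\<in>I. h k) = (\<Sum>k\<in>int ` I. h (nat k))"
  by (subst sum.reindex) auto

text \<open>Serves twice: for uniqueness of components, with all degrees but one in the span, and
  for the absence of negative degrees, with \<open>k < 0\<close> against all of
  \<open>V\<close>.\<close>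

lemma Gz_disjoint_span:
  assumes "x \<in> Gz k" "x \<in> span (\<Union>j\<in>J. Vgr smul Y cv j)" "\<And>j. j \<in> J \<Longrightarrow> int j \<noteq> k"
  shows "x = 0"
proof -
  obtain I f where f: "finite I" "I \<subseteq> J" "\<And>k. f k \<in> Vgr smul Y cv k" "x = (\<Sum>k\<in>I. f k)"
    using span_graded[OF assms(2)] by blast
  \<comment> \<open>The expansion of \<open>x\<close>, together with \<open>- x\<close> placed in
    degree \<open>k\<close>, is a vanishing sum of eigenvectors.\<close>
  define g where "g i = (if i = k then - x else f (nat i))" for i :: int
  have k: "k \<notin> int ` I" using f assms by auto
  have "g k = 0"
  proof (rule independent_graded[of "insert k (int ` I)"])
    show "g i \<in> Gz i" if "i \<in> insert k (int ` I)" for i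
      using that f(3)[of "nat i"] assms(1) by (auto simp: g_def Vgr_eq subspace_neg[OF subspace_Gz])
    have "(\<Sum>i\<in>int ` I. g i) = x"
      unfolding f(4) sum_int_image[of f I] by (rule sum.cong) (use k in \<open>auto simp: g_def\<close>)
    then show "(\<Sum>i\<in>insert k (int ` I). g i) = 0"
      using f k by (simp add: g_def)
  qed (use f in auto)
  then show ?thesis by (simp add: g_def)
qed

lemma Gz_neg:
  assumes "x \<in> Gz k" "k < 0"
  shows "x = 0"
proof (rule Gz_disjoint_span[OF assms(1), of UNIV])
  show "x \<in> span (\<Union>j\<in>UNIV. Vgr smul Y cv j)"
    using VOA by (simp add: is_VOA_def)
qed (use assms in auto)

lemma comp_unique:
  assumes "x \<in> Vgr smul Y cv d" "a - x \<in> span (\<Union>k\<in>-{d}. Vgr smul Y cv k)"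
  shows "cmp d a = x"
  unfolding comp_def
proof (rule the_equality)
  fix y assume y: "y \<in> Vgr smul Y cv d \<and> a - y \<in> span (\<Union>k\<in>- {d}. Vgr smul Y cv k)"
  have "y - x = 0"
  proof (rule Gz_disjoint_span)
    show "y - x \<in> Gz (int d)" using assms y by (simp add: Vgr_eq subspace_diff[OF subspace_Gz])
    have "(a - x) - (a - y) \<in> span (\<Union>k\<in>- {d}. Vgr smul Y cv k)"
      using assms y by (blast intro: span_diff)
    then show "y - x \<in> span (\<Union>k\<in>- {d}. Vgr smul Y cv k)" by simp
  qed auto
  then show "y = x" by simp
qed (use assms in auto)

lemma comp_sum:
  assumes "finite I" "\<And>k. f k \<in> Vgr smul Y cv k" "\<And>k. k \<notin> I \<Longrightarrow> f k = 0"
  shows "cmp d (\<Sum>k\<in>I. f k) = f d"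
proof (rule comp_unique)
  have "(\<Sum>k\<in>I. f k) = (\<Sum>k\<in>insert d I. f k)"
    by (rule sum.mono_neutral_left) (use assms in auto)
  also have "\<dots> = f d + (\<Sum>k\<in>I - {d}. f k)"
    using assms by (simp add: sum.insert_remove)
  finally have "(\<Sum>k\<in>I. f k) - f d = (\<Sum>k\<in>I - {d}. f k)" by simp
  moreover have "(\<Sum>k\<in>I - {d}. f k) \<in> span (\<Union>k\<in>- {d}. Vgr smul Y cv k)"
    using assms(2) by (intro span_sum span_base) blast
  ultimately show "(\<Sum>k\<in>I. f k) - f d \<in> span (\<Union>k\<in>- {d}. Vgr smul Y cv k)"
    by simp
qed (use assms in auto)

lemma comp_decomposition:
  "finite {d. cmp d a \<noteq> 0}" "cmp d a \<in> Gz (int d)" "a = (\<Sum>d | cmp d a \<noteq> 0. cmp d a)"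
proof -
  have "a \<in> span (\<Union>k\<in>UNIV. Vgr smul Y cv k)"
    using VOA by (simp add: is_VOA_def)
  then obtain I f where f: "finite I" "\<And>k. f k \<in> Vgr smul Y cv k" "\<And>k. k \<notin> I \<Longrightarrow> f k = 0"
      "a = (\<Sum>k\<in>I. f k)"
    using span_graded[of a UNIV] by auto
  have c: "cmp d a = f d" for d
    unfolding f(4) by (rule comp_sum) (use f in auto)
  show "finite {d. cmp d a \<noteq> 0}" unfolding c
    by (rule finite_subset[of _ I]) (use f in auto)
  show "cmp d a \<in> Gz (int d)" using f(2)[of d] by (simp add: c Vgr_eq)
  have "(\<Sum>k\<in>I. f k) = (\<Sum>d | f d \<noteq> 0. f d)"
    by (rule sum.mono_neutral_right) (use f in auto)
  then show "a = (\<Sum>d | cmp d a \<noteq> 0. cmp d a)"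
    unfolding c using f(4) by simp
qed

lemma comp_homogeneous:
  assumes "a \<in> Gz (int d)"
  shows "cmp e a = (if e = d then a else 0)"
proof -
  have "cmp e (\<Sum>k\<in>{d}. if k = d then a else 0) = (if e = d then a else 0)"
    by (rule comp_sum) (use assms in \<open>auto simp: Vgr_eq\<close>)
  then show ?thesis by simp
qed

section \<open>Modes indexed by the energy they lower\<close>

abbreviation "pm \<equiv> pmode smul Y cv"

lemma pmode_homogeneous:
  assumes "a \<in> Gz k"
  shows "pm a n b = Y a (n + k - 1) b"
proof (cases "a = 0")
  case True
  then have "cmp e a = 0" for e using comp_homogeneous[of 0 e] by simp
  then show ?thesis using True by (simp add: pmode_def Y_zero_left)
next
  case False
  then have "k \<ge> 0" using Gz_neg[OF assms] by force
  then obtain d where d: "k = int d" by (metis nonneg_int_cases)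
  have "{e. cmp e a \<noteq> 0} = {d}" using comp_homogeneous[of a d] assms False by (auto simp: d)
  then show ?thesis using comp_homogeneous[of a d] assms False by (simp add: pmode_def d)
qed

text \<open>The commutator with \<open>L 0\<close>, which is the standard mode \<open>1\<close> of
  \<open>cv\<close>, contains only \<open>L (-1) a\<close> and \<open>L 0 a\<close>; the first
  contributes the factor \<open>- m - 1\<close> by translation, the second the factor
  \<open>d\<close>. The separate variable \<open>k\<close> lets the target degree be matched up to
  arithmetic.\<close>

lemma Y_grade:
  assumes a: "a \<in> Gz d" and c: "c \<in> Gz n" and k: "k = n + d - m - 1"
  shows "Y a m c \<in> Gz k"
proof -
  obtain N where N: "\<And>j. j \<ge> N \<Longrightarrow> Y cv j a = 0" using Y_truncation[of cv a] by auto
  define J where "J = max 2 (nat N)"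
  have "Y cv 1 (Y a m c) - Y a m (Y cv 1 c)
      = (\<Sum>i<J. smul (of_int 1 gchoose i) (Y (Y cv (int i) a) (1 + m - int i) c))"
    by (rule Y_commutator) (use N in \<open>auto simp: J_def\<close>)
  also have "\<dots> = (\<Sum>i<2. smul (of_int 1 gchoose i) (Y (Y cv (int i) a) (1 + m - int i) c))"
  proof (rule sum.mono_neutral_right)
    have "(1::complex) gchoose i = 0" if "i \<ge> 2" for i
      using that by (subst of_nat_1[symmetric], subst binomial_gbinomial[symmetric]) simp
    then show "\<forall>i\<in>{..<J} - {..<2}.
       smul (of_int 1 gchoose i) (Y (Y cv (int i) a) (1 + m - int i) c) = 0" by simp
  qed (auto simp: J_def)
  also have "\<dots> = Y (L (-1) a) (m + 1) c + Y (L 0 a) m c"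
    by (simp add: numeral_2_eq_2 Lmode_def add.commute)
  also have "\<dots> = smul (of_int (- m - 1)) (Y a m c) + smul (of_int d) (Y a m c)"
    using a by (simp add: L_deriv Gz_def Y_scale_left)
  finally have "Y cv 1 (Y a m c) = smul (of_int n) (Y a m c)
      + (smul (of_int (- m - 1)) (Y a m c) + smul (of_int d) (Y a m c))"
    using c by (simp add: Gz_def Lmode_def Y_scale algebra_simps)
  also have "\<dots> = smul (of_int k) (Y a m c)"
    by (simp add: k flip: scale_left_distrib)
  finally show ?thesis by (simp add: Gz_def Lmode_def)
qed

text \<open>In both cases the central term is absent: either \<open>m + n \<noteq> 0\<close>, or
  \<open>m = 1\<close>, where \<open>m ^ 3 - m = 0\<close>.\<close>

lemma virasoro:
  "m + n \<noteq> 0 \<Longrightarrow> L m (L n v) = L n (L m v) + smul (of_int (m - n)) (L (m + n) v)"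
  "L 1 (L (-1) v) = L (-1) (L 1 v) + smul 2 (L 0 v)"
proof -
  obtain c :: complex where c: "\<And>m n v. L m (L n v) - L n (L m v)
        = smul (of_int (m - n)) (L (m + n) v)
          + (if m + n = 0 then smul (c / 12 * of_int (m ^ 3 - m)) v else 0)"
    using VOA unfolding is_VOA_def by (elim conjE exE) (rule that, blast)
  show "m + n \<noteq> 0 \<Longrightarrow> L m (L n v) = L n (L m v) + smul (of_int (m - n)) (L (m + n) v)"
    using c[of m n v] by (simp add: algebra_simps)
  show "L 1 (L (-1) v) = L (-1) (L 1 v) + smul 2 (L 0 v)"
    using c[of 1 "-1" v] by (simp add: algebra_simps)
qed

lemma vac_Gz: "vac \<in> Gz 0"
  using VOA by (simp add: is_VOA_def Gz_def Lmode_def)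

text \<open>\<open>cv\<close> is \<open>L (-2)\<close> applied to the vacuum, which has degree
  \<open>0\<close>, and \<open>L (-2)\<close> raises the degree by two.\<close>

lemma cv_Gz: "cv \<in> Gz 2"
proof -
  have cv: "L (-2) vac = cv" using VOA by (simp add: is_VOA_def Lmode_def)
  have "L 0 (L (-2) vac) = L (-2) (L 0 vac) + smul 2 (L (-2) vac)"
    using virasoro(1)[of 0 "-2" vac] by simp
  also have "L (-2) (L 0 vac) = 0" using vac_Gz by (simp add: Gz_def L_linear)
  finally show ?thesis by (simp add: cv Gz_def)
qed

lemma pmode_cv: "pm cv n = L n"
  using pmode_homogeneous[OF cv_Gz] by (auto simp: Lmode_def add.commute)

lemma L_grade: "c \<in> Gz n \<Longrightarrow> k = n - m \<Longrightarrow> L m c \<in> Gz k"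
  unfolding Lmode_def by (rule Y_grade[OF cv_Gz]) auto

lemma pmode_grade:
  assumes "c \<in> Gz n"
  shows "pm a m c \<in> Gz (n - m)"
  unfolding pmode_def
  by (intro subspace_sum[OF subspace_Gz] Y_grade[OF comp_decomposition(2) assms]) auto

text \<open>For \<open>a\<close> of degree \<open>d\<close>, \<open>Y a (d - 1)\<close> and
  \<open>Y a (d - 2)\<close> are \<open>pm a 0\<close> and \<open>pm a (-1)\<close>, and
  \<open>Y (L 1 a) (d - 2)\<close> is the zero mode of \<open>L 1 a\<close>. Hence for
  \<open>d > 0\<close> the zero mode is expressed by a nonzero mode and a vector of degree
  \<open>d - 1\<close>. The coefficient is \<open>2 * d - d\<close>, from \<open>L 0 a\<close> and
  \<open>L (-1) a\<close>.\<close>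

lemma L1_commutator:
  assumes a: "a \<in> Gz d"
  shows "smul (of_int d) (Y a (d - 1) c)
    = L 1 (Y a (d - 2) c) - Y a (d - 2) (L 1 c) - Y (L 1 a) (d - 2) c"
proof -
  obtain N where N: "\<And>j. j \<ge> N \<Longrightarrow> Y cv j a = 0" using Y_truncation[of cv a] by auto
  define J where "J = max 3 (nat N)"
  have "Y cv 2 (Y a (d - 2) c) - Y a (d - 2) (Y cv 2 c)
      = (\<Sum>i<J. smul (of_int 2 gchoose i) (Y (Y cv (int i) a) (2 + (d - 2) - int i) c))"
    by (rule Y_commutator) (use N in \<open>auto simp: J_def\<close>)
  also have "\<dots> = (\<Sum>i<3. smul (of_int 2 gchoose i) (Y (Y cv (int i) a) (2 + (d - 2) - int i) c))"
  proof (rule sum.mono_neutral_right)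
    have "(2::complex) gchoose i = 0" if "i \<ge> 3" for i
      using that by (subst of_nat_numeral[symmetric], subst binomial_gbinomial[symmetric]) simp
    then show "\<forall>i\<in>{..<J} - {..<3}.
       smul (of_int 2 gchoose i) (Y (Y cv (int i) a) (2 + (d - 2) - int i) c) = 0" by simp
  qed (auto simp: J_def)
  also have "\<dots> = Y (L (-1) a) d c + smul 2 (Y (L 0 a) (d - 1) c) + Y (L 1 a) (d - 2) c"
  proof -
    have "(2::complex) gchoose 2 = 1" by (simp add: gbinomial_Suc numeral_2_eq_2)
    then show ?thesis by (simp add: eval_nat_numeral Lmode_def add_ac)
  qed
  also have "\<dots> = smul (of_int d) (Y a (d - 1) c) + Y (L 1 a) (d - 2) c"
    using a by (simp add: L_deriv Gz_def Y_scale_left flip: scale_left_distrib scale_minus_left)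
  finally show ?thesis by (simp add: Lmode_def algebra_simps)
qed

subsection \<open>The scalar product\<close>

abbreviation "nrm \<equiv> vnorm sp"

lemmas unitary_conjs = unitary[unfolded is_unitary_VOA_def, THEN conjunct2]
lemmas unitary_linear = unitary_conjs[THEN conjunct1, rule_format]
  and unitary_cnj = unitary_conjs[THEN conjunct2, THEN conjunct1, rule_format]
  and unitary_pos = unitary_conjs[THEN conjunct2, THEN conjunct2, THEN conjunct1, rule_format]
lemmas unitary_star_conjs = unitary_conjs[THEN conjunct2, THEN conjunct2, THEN conjunct2,
    THEN conjunct2, THEN conjunct2]
lemmas star_star = unitary_star_conjs[THEN conjunct1, rule_format]
  and star_cv = unitary_star_conjs[THEN conjunct2, THEN conjunct1]
  and adjoint = unitary_star_conjs[THEN conjunct2, THEN conjunct2, rule_format]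

lemma sp_linear: "sp (a + b) c = sp a c + sp b c" "sp (smul x a) c = x * sp a c" "sp 0 c = 0"
  "sp (a - b) c = sp a c - sp b c"
proof -
  have *: "sp (smul x a + b) c = x * sp a c + sp b c" for x a b
    using unitary_linear by blast
  show 1: "sp (a + b) c = sp a c + sp b c" for a b using *[of 1 a b] by simp
  show 0: "sp 0 c = 0" using 1[of 0 0] by simp
  show "sp (smul x a) c = x * sp a c" using *[of x a 0] 0 by simp
  show "sp (a - b) c = sp a c - sp b c" using 1[of "a - b" b] by simp
qed

lemma sp_cnj: "cnj (sp a b) = sp b a"
  using unitary_cnj by metis

lemma sp_antilinear: "sp c (a + b) = sp c a + sp c b" "sp c (smul x a) = cnj x * sp c a" "sp c 0 = 0"
  "sp c (a - b) = sp c a - sp c b"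
proof -
  have r: "sp c z = cnj (sp z c)" for z by (simp add: sp_cnj)
  show "sp c (a + b) = sp c a + sp c b" unfolding r[of "a + b"] r[of a] r[of b] sp_linear by simp
  show "sp c (a - b) = sp c a - sp c b" unfolding r[of "a - b"] r[of a] r[of b] sp_linear by simp
  show "sp c (smul x a) = cnj x * sp c a" unfolding r[of "smul x a"] r[of a] sp_linear by simp
  show "sp c 0 = 0" unfolding r[of 0] sp_linear by simp
qed

lemma sp_sum: "sp (sum f I) c = (\<Sum>i\<in>I. sp (f i) c)" "sp c (sum f I) = (\<Sum>i\<in>I. sp c (f i))"
  by (induction I rule: infinite_finite_induct; simp add: sp_linear sp_antilinear)+

lemma sp_nonneg: "Re (sp a a) \<ge> 0"
proof (cases "a = 0")
  case False
  then show ?thesis using unitary_pos less_imp_le by blast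
qed (simp add: sp_linear)

lemma nrm_square: "(nrm a)\<^sup>2 = Re (sp a a)" "sp a a = of_real ((nrm a)\<^sup>2)"
proof -
  show 1: "(nrm a)\<^sup>2 = Re (sp a a)" using sp_nonneg[of a] by (simp add: vnorm_def)
  have "Im (sp a a) = 0" using arg_cong[OF sp_cnj[of a a], of Im] by simp
  then show "sp a a = of_real ((nrm a)\<^sup>2)" by (simp add: 1 complex_eq_iff)
qed

lemma nrm_nonneg [simp]: "nrm a \<ge> 0"
  using sp_nonneg[of a] by (simp add: vnorm_def)

lemma nrm_zero [simp]: "nrm 0 = 0"
  by (simp add: vnorm_def sp_linear)

lemma nrm_pos: "a \<noteq> 0 \<Longrightarrow> nrm a > 0"
  using unitary_pos by (simp add: vnorm_def)

lemma nrm_scale: "nrm (smul x a) = norm x * nrm a"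
proof -
  have "sp (smul x a) (smul x a) = of_real ((norm x)\<^sup>2) * sp a a"
    by (simp only: sp_linear sp_antilinear complex_norm_square mult.assoc mult.left_commute)
  then have "(nrm (smul x a))\<^sup>2 = (norm x * nrm a)\<^sup>2"
    by (simp only: nrm_square(1) power_mult_distrib times_complex.sel Re_complex_of_real Im_complex_of_real mult_zero_left diff_zero)
  then show ?thesis by simp
qed

lemma cauchy_schwarz: "norm (sp a b) \<le> nrm a * nrm b"
proof (cases "b = 0")
  case False
  define t where "t = sp a b"
  have n: "nrm b > 0" using False nrm_pos by simp
  \<comment> \<open>The usual projection of \<open>a\<close> off \<open>b\<close>, multiplied by the
    square norm of \<open>b\<close> to avoid division.\<close>
  have "sp (smul (of_real ((nrm b)\<^sup>2)) a - smul t b) (smul (of_real ((nrm b)\<^sup>2)) a - smul t b)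
     = of_real ((nrm b)\<^sup>2 * ((nrm b)\<^sup>2 * (nrm a)\<^sup>2 - (norm t)\<^sup>2))"
    unfolding sp_linear sp_antilinear nrm_square(2)[of a] nrm_square(2)[of b]
      sp_cnj[of a b, symmetric] t_def[symmetric]
    by (simp only: of_real_mult of_real_diff complex_norm_square[of t] complex_cnj_complex_of_real)
      algebra
  then have "(nrm b)\<^sup>2 * ((nrm b)\<^sup>2 * (nrm a)\<^sup>2 - (norm t)\<^sup>2) \<ge> 0"
    using sp_nonneg[of "smul (of_real ((nrm b)\<^sup>2)) a - smul t b"]
    by (simp only: Re_complex_of_real)
  then have "(norm t)\<^sup>2 \<le> (nrm a * nrm b)\<^sup>2"
    using n by (simp add: zero_le_mult_iff power_mult_distrib mult.commute)
  then show ?thesis unfolding t_def by (rule power2_le_imp_le) simp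
qed (simp add: sp_antilinear)

lemma nrm_triangle: "nrm (a + b) \<le> nrm a + nrm b"
proof (rule power2_le_imp_le)
  have "(nrm (a + b))\<^sup>2 = (nrm a)\<^sup>2 + (nrm b)\<^sup>2 + 2 * Re (sp a b)"
    unfolding nrm_square(1) sp_linear sp_antilinear using sp_cnj[of a b] 
    by (simp add: complex_eq_iff)
  also have "Re (sp a b) \<le> nrm a * nrm b"
    using cauchy_schwarz[of a b] complex_Re_le_cmod order_trans by blast
  finally show "(nrm (a + b))\<^sup>2 \<le> (nrm a + nrm b)\<^sup>2"
    by (simp add: power2_sum)
qed simp

lemma nrm_minus: "nrm (- a) = nrm a"
  using nrm_scale[of "-1" a] by simp

lemma nrm_diff: "nrm (a - b) \<le> nrm a + nrm b"
  using nrm_triangle[of a "- b"] nrm_minus[of b] by simp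

lemma nrm_sum: "nrm (sum f I) \<le> (\<Sum>i\<in>I. nrm (f i))"
  by (induction I rule: infinite_finite_induct) (auto intro: order_trans[OF nrm_triangle])

lemma L_adjoint: "sp b (L n c) = sp (L (- n) b) c"
  using adjoint[of b cv n c] by (simp add: pmode_cv star_cv)

lemma Gz_orthogonal:
  assumes "x \<in> Gz i" "y \<in> Gz j" "i \<noteq> j"
  shows "sp x y = 0"
proof -
  have "sp x (L 0 y) = sp (L 0 x) y" using L_adjoint[of x 0 y] by simp
  then show ?thesis using assms by (simp add: Gz_def sp_linear sp_antilinear)
qed

text \<open>By orthogonality, pairing the sum with \<open>f k\<close> leaves the square norm of
  \<open>f k\<close>; Cauchy-Schwarz gives the bound after cancelling one factor
  \<open>nrm (f k)\<close>.\<close>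

lemma nrm_component_le:
  assumes "finite I" "\<And>k. k \<in> I \<Longrightarrow> f k \<in> Gz (int k)" "k \<in> I"
  shows "nrm (f k) \<le> nrm (\<Sum>k\<in>I. f k)"
proof (cases "f k = 0")
  case False
  have "sp (\<Sum>k\<in>I. f k) (f k) = (\<Sum>j\<in>I. if j = k then sp (f k) (f k) else 0)"
    unfolding sp_sum
  proof (intro sum.cong refl)
    fix j assume "j \<in> I"
    then show "sp (f j) (f k) = (if j = k then sp (f k) (f k) else 0)"
      using Gz_orthogonal[OF assms(2)[of j] assms(2)[OF assms(3)]] by auto
  qed
  also have "\<dots> = of_real ((nrm (f k))\<^sup>2)" using assms nrm_square(2) by simp
  finally have "norm (of_real ((nrm (f k))\<^sup>2) :: complex) \<le> nrm (\<Sum>k\<in>I. f k) * nrm (f k)"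
    using cauchy_schwarz[of "\<Sum>k\<in>I. f k" "f k"] by (simp only:)
  then have "(nrm (f k))\<^sup>2 \<le> nrm (\<Sum>k\<in>I. f k) * nrm (f k)"
    by (simp only: norm_of_real abs_power2)
  then show ?thesis using nrm_pos[OF False] by (simp add: power2_eq_square)
qed simp


subsection \<open>Families of operators of controlled growth\<close>

text \<open>Bounds are imposed on homogeneous vectors only, up to a polynomial in mode and degree
  and a fixed shift in the argument of \<open>g\<close>; leaving these constants existential makes
  the notion stable under the operations below. For \<open>g = 1\<close> and \<open>T = pm a\<close>
  it amounts to energy bounds for \<open>a\<close>. The value of \<open>nat k\<close> for
  \<open>k < 0\<close> is immaterial, as \<open>Gz k\<close> is then zero.\<close>

definition dominated :: "(nat \<Rightarrow> real) \<Rightarrow> (int \<Rightarrow> 'v \<Rightarrow> 'v) \<Rightarrow> bool" where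
  "dominated g T \<longleftrightarrow> (\<exists>C s c0. C \<ge> 0 \<and> (\<forall>m k. \<forall>c\<in>Gz k.
     nrm (T m c) \<le> C * (1 + \<bar>of_int m\<bar> + \<bar>of_int k\<bar>) ^ s * g (nat k + c0) * nrm c))"

lemma dominatedI:
  assumes "C \<ge> 0" "\<And>m k c. c \<in> Gz k \<Longrightarrow>
     nrm (T m c) \<le> C * (1 + \<bar>of_int m\<bar> + \<bar>of_int k\<bar>) ^ s * g (nat k + c0) * nrm c"
  shows "dominated g T"
  using assms unfolding dominated_def by blast

lemma dominatedI_nat:
  assumes "C \<ge> 0" "\<And>m. T m 0 = 0" "\<And>m n c. c \<in> Gz (int n) \<Longrightarrow>
     nrm (T m c) \<le> C * (1 + \<bar>of_int m\<bar> + real n) ^ s * g (n + c0) * nrm c"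
  shows "dominated g T"
proof (rule dominatedI[OF assms(1)])
  fix m k c assume c: "c \<in> Gz k"
  show "nrm (T m c) \<le> C * (1 + \<bar>of_int m\<bar> + \<bar>of_int k\<bar>) ^ s * g (nat k + c0) * nrm c"
  proof (cases "k < 0")
    case True
    then show ?thesis using Gz_neg[OF c] assms(2) by simp
  next
    case False
    then show ?thesis using assms(3)[of c "nat k" m] c by simp
  qed
qed

lemma dominated_zero: "growth g \<Longrightarrow> dominated g (\<lambda>_ _. 0)"
  by (rule dominatedI[of 0]) auto

lemma dominated_le:
  assumes "dominated g T" "\<And>m k c. c \<in> Gz k \<Longrightarrow> nrm (S m c) \<le> nrm (T m c)"
  shows "dominated g S"
proof -
  obtain C s c0 where *: "C \<ge> 0" "\<And>m k c. c \<in> Gz k \<Longrightarrow>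
     nrm (T m c) \<le> C * (1 + \<bar>of_int m\<bar> + \<bar>of_int k\<bar>) ^ s * g (nat k + c0) * nrm c"
    using assms(1) unfolding dominated_def by blast
  show ?thesis
    by (rule dominatedI[OF *(1)]) (use order_trans[OF assms(2) *(2)] in blast)
qed

lemma dominated_weaken:
  assumes "growth g" "C \<le> C'" "s \<le> s'" "n \<le> n'" "X \<ge> 1" "0 \<le> C" "0 \<le> N" "X \<le> X'"
  shows "C * X ^ s * g n * N \<le> C' * X' ^ s' * g n' * (N::real)"
proof -
  have "X ^ s \<le> X' ^ s'"
    using power_increasing[OF assms(3,5)] power_mono[OF assms(8), of s'] assms(5) by linarith
  then show ?thesis
    using assms growth_mono[OF assms(1,4)] growth_ge0[OF assms(1)]
    by (intro mult_mono) auto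
qed

lemma dominated_add:
  assumes g: "growth g" and "dominated g T" "dominated g S"
  shows "dominated g (\<lambda>m c. T m c + S m c)"
proof -
  obtain C s c0 where 1: "C \<ge> 0" "\<And>m k c. c \<in> Gz k \<Longrightarrow>
     nrm (T m c) \<le> C * (1 + \<bar>of_int m\<bar> + \<bar>of_int k\<bar>) ^ s * g (nat k + c0) * nrm c"
    using assms(2) unfolding dominated_def by blast
  obtain C' s' c0' where 2: "C' \<ge> 0" "\<And>m k c. c \<in> Gz k \<Longrightarrow>
     nrm (S m c) \<le> C' * (1 + \<bar>of_int m\<bar> + \<bar>of_int k\<bar>) ^ s' * g (nat k + c0') * nrm c"
    using assms(3) unfolding dominated_def by blast
  show ?thesis
  proof (rule dominatedI[of "C + C'"])
    fix m k c assume c: "c \<in> Gz k"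
    let ?X = "1 + \<bar>of_int m\<bar> + \<bar>of_int k\<bar> :: real"
    have "nrm (T m c + S m c) \<le> nrm (T m c) + nrm (S m c)" by (rule nrm_triangle)
    also have "\<dots> \<le> C * ?X ^ s * g (nat k + c0) * nrm c + C' * ?X ^ s' * g (nat k + c0') * nrm c"
      using 1(2)[OF c] 2(2)[OF c] by (rule add_mono)
    also have "\<dots> \<le> C * ?X ^ (s + s') * g (nat k + (c0 + c0')) * nrm c
        + C' * ?X ^ (s + s') * g (nat k + (c0 + c0')) * nrm c"
      by (intro add_mono dominated_weaken[OF g]) (use 1 2 in auto)
    finally show "nrm (T m c + S m c) \<le> (C + C') * ?X ^ (s + s') * g (nat k + (c0 + c0')) * nrm c"
      by (simp add: algebra_simps)
  qed (use 1 2 in auto)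
qed

lemma dominated_scale:
  assumes g: "growth g" and "dominated g T" and f: "F \<ge> 0" "\<And>m. norm (f m) \<le> F * (1 + \<bar>of_int m\<bar>) ^ p"
  shows "dominated g (\<lambda>m c. smul (f m) (T m c))"
proof -
  obtain C s c0 where 1: "C \<ge> 0" "\<And>m k c. c \<in> Gz k \<Longrightarrow>
     nrm (T m c) \<le> C * (1 + \<bar>of_int m\<bar> + \<bar>of_int k\<bar>) ^ s * g (nat k + c0) * nrm c"
    using assms(2) unfolding dominated_def by blast
  show ?thesis
  proof (rule dominatedI[of "F * C"])
    fix m k c assume c: "c \<in> Gz k"
    let ?X = "1 + \<bar>of_int m\<bar> + \<bar>of_int k\<bar> :: real"
    have "norm (f m) \<le> F * (1 + \<bar>of_int m\<bar>) ^ p" by (rule f)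
    also have "\<dots> \<le> F * ?X ^ p" using f by (intro mult_left_mono power_mono) auto
    finally have "nrm (smul (f m) (T m c)) \<le> F * ?X ^ p * (C * ?X ^ s * g (nat k + c0) * nrm c)"
      unfolding nrm_scale using 1(2)[OF c] f by (intro mult_mono) auto
    then show "nrm (smul (f m) (T m c)) \<le> F * C * ?X ^ (p + s) * g (nat k + c0) * nrm c"
      by (simp add: power_add mult_ac)
  qed (use 1 f in auto)
qed

lemma dominated_smul: "growth g \<Longrightarrow> dominated g T \<Longrightarrow> dominated g (\<lambda>m c. smul x (T m c))"
  by (rule dominated_scale[of _ _ "norm x" _ 0]) auto

lemma dominated_diff:
  assumes "growth g" "dominated g T" "dominated g S"
  shows "dominated g (\<lambda>m c. T m c - S m c)"
  using dominated_add[OF assms(1,2) dominated_smul[OF assms(1,3), of "-1"]] by simp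

lemma dominated_sum:
  assumes g: "growth g" and "\<And>i. i \<in> I \<Longrightarrow> dominated g (T i)"
  shows "dominated g (\<lambda>m c. \<Sum>i\<in>I. T i m c)"
  using assms(2)
  by (induction I rule: infinite_finite_induct) (auto intro: dominated_add[OF g] dominated_zero[OF g])

lemma dominated_shift:
  assumes g: "growth g" and "dominated g T"
  shows "dominated g (\<lambda>m. T (m + j))"
proof -
  obtain C s c0 where 1: "C \<ge> 0" "\<And>m k c. c \<in> Gz k \<Longrightarrow>
     nrm (T m c) \<le> C * (1 + \<bar>of_int m\<bar> + \<bar>of_int k\<bar>) ^ s * g (nat k + c0) * nrm c"
    using assms(2) unfolding dominated_def by blast
  show ?thesis
  proof (rule dominatedI[of "C * (1 + \<bar>of_int j\<bar>) ^ s"])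
    fix m k c assume c: "c \<in> Gz k"
    let ?X = "1 + \<bar>of_int m\<bar> + \<bar>of_int k\<bar> :: real"
    have "nrm (T (m + j) c) \<le> C * (1 + \<bar>of_int (m + j)\<bar> + \<bar>of_int k\<bar>) ^ s * g (nat k + c0) * nrm c"
      by (rule 1(2)[OF c])
    also have "\<dots> \<le> C * ((1 + \<bar>of_int j\<bar>) * ?X) ^ s * g (nat k + c0) * nrm c"
    proof (rule dominated_weaken[OF g])
      have "(1 + \<bar>of_int j\<bar>) * ?X = ?X + \<bar>of_int j\<bar> + \<bar>of_int j\<bar> * (\<bar>of_int m\<bar> + \<bar>of_int k\<bar>)"
        by (simp add: algebra_simps)
      moreover have "\<bar>of_int j\<bar> * (\<bar>of_int m\<bar> + \<bar>of_int k\<bar>) \<ge> (0::real)" by simp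
      ultimately show "1 + \<bar>of_int (m + j)\<bar> + \<bar>of_int k\<bar> \<le> (1 + \<bar>of_int j\<bar>) * ?X"
        using abs_triangle_ineq[of "of_int m :: real" "of_int j"] by (simp only: of_int_add)
    qed (use 1 in auto)
    finally show "nrm (T (m + j) c)
        \<le> C * (1 + \<bar>of_int j\<bar>) ^ s * (1 + \<bar>of_int m\<bar> + \<bar>of_int k\<bar>) ^ s * g (nat k + c0) * nrm c"
      by (simp add: power_mult_distrib mult_ac)
  qed (use 1 in auto)
qed

lemma dominated_const:
  assumes g: "growth g" and "dominated g T"
  shows "dominated g (\<lambda>_. T j)"
proof -
  obtain C s c0 where 1: "C \<ge> 0" "\<And>m k c. c \<in> Gz k \<Longrightarrow>
     nrm (T (m + j) c) \<le> C * (1 + \<bar>of_int m\<bar> + \<bar>of_int k\<bar>) ^ s * g (nat k + c0) * nrm c"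
    using dominated_shift[OF assms, of j] unfolding dominated_def by blast
  show ?thesis
  proof (rule dominatedI[OF 1(1)])
    fix m k c assume c: "c \<in> Gz k"
    have "nrm (T j c) \<le> C * (1 + \<bar>of_int 0\<bar> + \<bar>of_int k\<bar>) ^ s * g (nat k + c0) * nrm c"
      using 1(2)[OF c, of 0] by simp
    also have "\<dots> \<le> C * (1 + \<bar>of_int m\<bar> + \<bar>of_int k\<bar>) ^ s * g (nat k + c0) * nrm c"
      by (rule dominated_weaken[OF g]) (use 1 in auto)
    finally show "nrm (T j c) \<le> C * (1 + \<bar>of_int m\<bar> + \<bar>of_int k\<bar>) ^ s * g (nat k + c0) * nrm c" .
  qed
qed

lemma dominated_if:
  assumes g: "growth g" and "dominated g T" "dominated g S"
  shows "dominated g (\<lambda>m c. if P m then T m c else S m c)"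
proof -
  have "dominated g (\<lambda>m c. smul (if P m then 1 else 0) (T m c))"
    by (rule dominated_scale[OF g assms(2), of 1 _ 0]) auto
  moreover have "dominated g (\<lambda>m c. smul (if P m then 0 else 1) (S m c))"
    by (rule dominated_scale[OF g assms(3), of 1 _ 0]) auto
  ultimately have "dominated g (\<lambda>m c. smul (if P m then 1 else 0) (T m c) + smul (if P m then 0 else 1) (S m c))"
    by (rule dominated_add[OF g])
  then show ?thesis by (rule dominated_le) auto
qed

text \<open>The inner family changes the degree by \<open>\<sigma> m\<close>, so the outer bound is
  evaluated at degree \<open>k + \<sigma> m\<close>. The bound on \<open>\<sigma>\<close> keeps the
  polynomial factor polynomial, and \<open>gh\<close> combines the two growth factors into one; in
  the applications one of them is constant.\<close>

lemma dominated_comp: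
  assumes g: "growth g" "growth h" "growth f"
    and T: "dominated g T" and S: "dominated h S" 
    and grade: "\<And>m k c. c \<in> Gz k \<Longrightarrow> S m c \<in> Gz (k + \<sigma> m)" "\<And>m. \<bar>\<sigma> m\<bar> \<le> int e + \<bar>m\<bar>"
    and gh: "\<And>c0 c0'. \<exists>c1. \<forall>m n. g (nat (n + \<sigma> m) + c0) * h (nat n + c0') \<le> f (nat n + c1)"
  shows "dominated f (\<lambda>m c. T m (S m c))"
proof -
  obtain C s c0 where 1: "C \<ge> 0" "\<And>m k c. c \<in> Gz k \<Longrightarrow>
     nrm (T m c) \<le> C * (1 + \<bar>of_int m\<bar> + \<bar>of_int k\<bar>) ^ s * g (nat k + c0) * nrm c"
    using T unfolding dominated_def by blast
  obtain C' s' c0' where 2: "C' \<ge> 0" "\<And>m k c. c \<in> Gz k \<Longrightarrow>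
     nrm (S m c) \<le> C' * (1 + \<bar>of_int m\<bar> + \<bar>of_int k\<bar>) ^ s' * h (nat k + c0') * nrm c"
    using S unfolding dominated_def by blast
  obtain c1 where c1: "\<And>m n. g (nat (n + \<sigma> m) + c0) * h (nat n + c0') \<le> f (nat n + c1)"
    using gh by blast
  show ?thesis
  proof (rule dominatedI[of "C * real (2 + e) ^ s * C'"])
    fix m k c assume c: "c \<in> Gz k"
    let ?X = "1 + \<bar>of_int m\<bar> + \<bar>of_int k\<bar> :: real"
    have "nrm (T m (S m c)) \<le> C * (1 + \<bar>of_int m\<bar> + \<bar>of_int (k + \<sigma> m)\<bar>) ^ s
        * g (nat (k + \<sigma> m) + c0) * nrm (S m c)"
      by (rule 1(2)[OF grade(1)[OF c]])
    also have "\<dots> \<le> C * (real (2 + e) * ?X) ^ s * g (nat (k + \<sigma> m) + c0) * nrm (S m c)"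
    proof (rule dominated_weaken[OF g(1)])
      have "real_of_int \<bar>\<sigma> m\<bar> \<le> of_int (int e + \<bar>m\<bar>)" using grade(2) of_int_le_iff by blast
      then have "1 + \<bar>of_int m\<bar> + \<bar>of_int (k + \<sigma> m)\<bar> \<le> 2 * ?X + real e"
        by simp
      also have "real e \<le> real e * ?X" by (simp add: algebra_simps)
      finally show "1 + \<bar>of_int m\<bar> + \<bar>of_int (k + \<sigma> m)\<bar> \<le> real (2 + e) * ?X"
        by (simp add: algebra_simps)
    qed (use 1 in auto)
    also have "\<dots> \<le> C * (real (2 + e) * ?X) ^ s * g (nat (k + \<sigma> m) + c0)
        * (C' * ?X ^ s' * h (nat k + c0') * nrm c)"
      using 1 growth_ge0[OF g(1)] by (intro mult_left_mono 2(2)[OF c]) auto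
    also have "\<dots> = C * real (2 + e) ^ s * C' * ?X ^ (s + s')
        * (g (nat (k + \<sigma> m) + c0) * h (nat k + c0')) * nrm c"
      by (simp add: power_add power_mult_distrib mult_ac)
    also have "\<dots> \<le> C * real (2 + e) ^ s * C' * ?X ^ (s + s') * f (nat k + c1) * nrm c"
      by (intro mult_right_mono mult_left_mono c1) (use 1 2 in auto)
    finally show "nrm (T m (S m c)) \<le> C * real (2 + e) ^ s * C' * ?X ^ (s + s') * f (nat k + c1) * nrm c" .
  qed (use 1 2 in auto)
qed

section \<open>Bounding all modes by zero modes\<close>

text \<open>\<open>X\<close> plays the adjoint of the lowering operator \<open>A\<close>:
  \<open>step\<close> comes from the commutator and \<open>adj\<close> from Cauchy-Schwarz. By
  induction the square norm of \<open>X\<close> on degree \<open>j = n - m\<close> is at most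
  \<open>(j + 1) * Q j\<close>, hence at most \<open>n * Q n\<close> because
  \<open>m \<ge> 1\<close>; \<open>adj\<close> passes this bound to \<open>A\<close> on degree
  \<open>n\<close>, and \<open>step\<close> then bounds \<open>X\<close> there.\<close>

lemma ladder_bound:
  assumes m: "m \<ge> (1::int)"
    and A: "\<And>k c. c \<in> Gz k \<Longrightarrow> A c \<in> Gz (k - m)"
    and Q: "\<And>n. Q n \<ge> 0" "\<And>i j. i \<le> j \<Longrightarrow> Q i \<le> Q j"
    and step: "\<And>n c. c \<in> Gz (int n) \<Longrightarrow> (nrm (X c))\<^sup>2 \<le> (nrm (A c))\<^sup>2 + Q n * (nrm c)\<^sup>2"
    and adj: "\<And>c. (nrm (A c))\<^sup>2 \<le> nrm c * nrm (X (A c))"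
    and c: "c \<in> Gz (int n)"
  shows "(nrm (A c))\<^sup>2 \<le> real n * Q n * (nrm c)\<^sup>2"
    and "(nrm (X c))\<^sup>2 \<le> real (Suc n) * Q n * (nrm c)\<^sup>2"
proof -
  have A_le: "(nrm (A c))\<^sup>2 \<le> real n * Q n * (nrm c)\<^sup>2" if "c \<in> Gz (int n)" for n c
    using that
  proof (induction n arbitrary: c rule: less_induct)
    case (less n)
    show ?case
    proof (cases "A c = 0")
      case True
      then show ?thesis using Q by simp
    next
      case False
      \<comment> \<open>A nonzero \<open>A c\<close> cannot have negative degree, so the recursion
        stops below degree \<open>m\<close>.\<close>
      then have "int n \<ge> m" using Gz_neg[OF A[OF less.prems]] by force
      define j where "j = nat (int n - m)"
      have j: "int j = int n - m" "j < n" using \<open>int n \<ge> m\<close> m by (auto simp: j_def)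
      have Ac: "A c \<in> Gz (int j)" using A[OF less.prems] by (simp add: j)
      define q where "q = real n * Q n"
      have "(nrm (X (A c)))\<^sup>2 \<le> real j * Q j * (nrm (A c))\<^sup>2 + Q j * (nrm (A c))\<^sup>2"
        using step[OF Ac] less.IH[OF j(2) Ac] by linarith
      also have "\<dots> = real (Suc j) * Q j * (nrm (A c))\<^sup>2" by (simp add: algebra_simps)
      also have "\<dots> \<le> q * (nrm (A c))\<^sup>2"
        unfolding q_def by (intro mult_right_mono mult_mono Q) (use j Q in auto)
      finally have 1: "(nrm (X (A c)))\<^sup>2 \<le> q * (nrm (A c))\<^sup>2" .
      have "((nrm (A c))\<^sup>2)\<^sup>2 \<le> (nrm c * nrm (X (A c)))\<^sup>2"
        by (intro power_mono adj) simp
      also have "\<dots> \<le> (nrm c)\<^sup>2 * (q * (nrm (A c))\<^sup>2)"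
        unfolding power_mult_distrib by (intro mult_left_mono 1) simp
      finally have "(nrm (A c))\<^sup>2 * (nrm (A c))\<^sup>2 \<le> (q * (nrm c)\<^sup>2) * (nrm (A c))\<^sup>2"
        by (simp add: power2_eq_square mult_ac)
      moreover have "(nrm (A c))\<^sup>2 > 0" using nrm_pos[OF False] by simp
      ultimately have "(nrm (A c))\<^sup>2 \<le> q * (nrm c)\<^sup>2" by (rule mult_right_le_imp_le)
      then show ?thesis unfolding q_def .
    qed
  qed
  then show "(nrm (A c))\<^sup>2 \<le> real n * Q n * (nrm c)\<^sup>2" using c .
  then show "(nrm (X c))\<^sup>2 \<le> real (Suc n) * Q n * (nrm c)\<^sup>2"
    using step[OF c] by (simp add: algebra_simps)
qed


text \<open>The point is that the vectors \<open>w\<close> do not depend on \<open>m\<close>; only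
  the coefficients do, and these polynomially. Decomposing both vectors into components avoids any
  appeal to the degree of \<open>star a\<close> in the application.\<close>

lemma pmode_commutator:
  obtains I :: "(nat \<times> nat \<times> nat) set" and w f where "finite I"
    "\<And>\<kappa>. \<kappa> \<in> I \<Longrightarrow> \<exists>F p. F \<ge> 0 \<and> (\<forall>m::int. norm (f \<kappa> m :: complex) \<le> F * (1 + \<bar>of_int m\<bar>) ^ p)"
    "\<And>m c. pm b m (pm a (- m) c)
       = pm a (- m) (pm b m c) + (\<Sum>\<kappa>\<in>I. smul (f \<kappa> m) (pm (w \<kappa>) 0 c))"
proof -
  define D where "D x = {d. cmp d x \<noteq> 0}" for x
  have D: "finite (D x)" for x unfolding D_def by (rule comp_decomposition)
  have "\<exists>J. \<forall>i\<ge>J. Y (cmp e b) (int i) (cmp d a) = 0" for e d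
  proof -
    obtain N where "\<forall>m\<ge>N. Y (cmp e b) m (cmp d a) = 0" using Y_truncation by blast
    then show ?thesis by (intro exI[of _ "nat N"]) auto
  qed
  then obtain J where J: "\<And>e d i. i \<ge> J e d \<Longrightarrow> Y (cmp e b) (int i) (cmp d a) = 0" by metis
  define I where "I = (SIGMA e:D b. SIGMA d:D a. {..<J e d})"
  define w where "w = (\<lambda>(e, d, j). Y (cmp e b) (int j) (cmp d a))"
  define f where "f = (\<lambda>(e, d :: nat, j) m. (of_int (m + int e - 1) :: complex) gchoose j)"
  show ?thesis
  proof (rule that[of I f w])
    show "finite I" unfolding I_def using D by auto
  next
    fix \<kappa> assume "\<kappa> \<in> I"
    obtain e d j where \<kappa>: "\<kappa> = (e, d, j)" by (cases \<kappa>)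
    have "norm (f \<kappa> m) \<le> real (1 + e + j) ^ j * (1 + \<bar>of_int m\<bar>) ^ j" for m
    proof -
      have "norm (f \<kappa> m) \<le> (norm (of_int (m + int e - 1) :: complex) + real j) ^ j"
        unfolding f_def \<kappa> prod.case by (rule gbinomial_norm_le)
      also have "\<dots> \<le> (real (1 + e + j) * (1 + \<bar>of_int m\<bar>)) ^ j"
      proof (rule power_mono)
        have "norm (of_int (m + int e - 1) :: complex) = \<bar>of_int m + real e - 1\<bar>"
          by (metis norm_of_int of_int_add of_int_diff of_int_of_nat_eq of_int_1)
        also have "\<dots> \<le> 1 + \<bar>of_int m\<bar> + real e" by linarith
        also have "\<dots> \<le> (1 + real e) * (1 + \<bar>of_int m\<bar>)" by (simp add: algebra_simps)
        finally have "norm (of_int (m + int e - 1) :: complex) + real j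
            \<le> (1 + real e) * (1 + \<bar>of_int m\<bar>) + real j * (1 + \<bar>of_int m\<bar>)"
          using mult_left_mono[of 1 "1 + \<bar>real_of_int m\<bar>" "real j"] by simp
        then show "norm (of_int (m + int e - 1) :: complex) + real j
            \<le> real (1 + e + j) * (1 + \<bar>of_int m\<bar>)"
          by (simp only: of_nat_add of_nat_1 distrib_right)
      qed simp
      finally show ?thesis by (simp add: power_mult_distrib)
    qed
    then show "\<exists>F p. F \<ge> 0 \<and> (\<forall>m::int. norm (f \<kappa> m) \<le> F * (1 + \<bar>of_int m\<bar>) ^ p)"
      by (intro exI[of _ "real (1 + e + j) ^ j"] exI[of _ j]) simp
  next
    fix m c
    have expand: "pm x n v = (\<Sum>d\<in>D x. Y (cmp d x) (n + int d - 1) v)" for x n v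
      unfolding D_def pmode_def ..
    \<comment> \<open>The vector has degree \<open>d + e - j - 1\<close> and its standard index is
      \<open>d + e - j - 2\<close>: the opposite modes \<open>m\<close> and \<open>- m\<close>
      cancel, so the term is a zero mode.\<close>
    have w: "pm (w (e, d, j)) 0 c
        = Y (Y (cmp e b) (int j) (cmp d a)) ((m + int e - 1) + (- m + int d - 1) - int j) c" for e d j
    proof -
      have "w (e, d, j) \<in> Gz (int d + int e - int j - 1)"
        unfolding w_def prod.case by (intro Y_grade[OF comp_decomposition(2) comp_decomposition(2)]) simp
      from pmode_homogeneous[OF this, of 0 c] show ?thesis by (simp add: w_def algebra_simps)
    qed
    have "pm b m (pm a (- m) c) - pm a (- m) (pm b m c)
        = (\<Sum>e\<in>D b. \<Sum>d\<in>D a. Y (cmp e b) (m + int e - 1) (Y (cmp d a) (- m + int d - 1) c)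
            - Y (cmp d a) (- m + int d - 1) (Y (cmp e b) (m + int e - 1) c))"
      unfolding expand Y_sum sum_subtractf
      by (subst sum.swap[where A = "D a"]) (rule refl)
    also have "\<dots> = (\<Sum>e\<in>D b. \<Sum>d\<in>D a. \<Sum>j<J e d. smul (f (e, d, j) m) (pm (w (e, d, j)) 0 c))"
      unfolding w unfolding f_def prod.case by (intro sum.cong refl Y_commutator J)
    also have "\<dots> = (\<Sum>\<kappa>\<in>I. smul (f \<kappa> m) (pm (w \<kappa>) 0 c))"
      unfolding I_def using D by (simp add: sum.Sigma split_def)
    finally show "pm b m (pm a (- m) c)
       = pm a (- m) (pm b m c) + (\<Sum>\<kappa>\<in>I. smul (f \<kappa> m) (pm (w \<kappa>) 0 c))"
      by (simp add: algebra_simps)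
  qed
qed

lemma pmode_hom: "pm a n 0 = 0" "pm a n (b + c) = pm a n b + pm a n c"
  "pm a n (smul x b) = smul x (pm a n b)"
  by (simp_all add: pmode_def Y_zero Y_add Y_scale sum.distrib scale_sum_right)

text \<open>For \<open>m \<ge> 1\<close> the square norms of \<open>a\<^sub>-\<^sub>m c\<close> and of its adjoint differ by an expectation value of
the commutator, which only involves zero modes. The adjoint lowers the energy by \<open>m\<close>, so
iterating ends after at most \<open>n\<close> steps.\<close>
lemma dominated_nonzero_modes:
  "\<exists>F. finite F \<and> (\<forall>g. growth g \<longrightarrow> (\<forall>w\<in>F. dominated g (\<lambda>_. pm w 0)) \<longrightarrow>
      dominated (\<lambda>n. sqrt (g n)) (\<lambda>m c. if m < 0 then pm a m c else 0) \<and>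
      dominated (\<lambda>n. sqrt (g n)) (\<lambda>m c. if m > 0 then pm (star a) m c else 0))"
proof (rule pmode_commutator[of "star a" a])
  fix I :: "(nat \<times> nat \<times> nat) set" and w f
  assume I: "finite I"
    "\<And>\<kappa>. \<kappa> \<in> I \<Longrightarrow> \<exists>F p. F \<ge> 0 \<and> (\<forall>m::int. norm (f \<kappa> m :: complex) \<le> F * (1 + \<bar>of_int m\<bar>) ^ p)"
    and comm: "\<And>m c. pm (star a) m (pm a (- m) c)
       = pm a (- m) (pm (star a) m c) + (\<Sum>\<kappa>\<in>I. smul (f \<kappa> m) (pm (w \<kappa>) 0 c))"
  define R where "R m c = (\<Sum>\<kappa>\<in>I. smul (f \<kappa> m) (pm (w \<kappa>) 0 c))" for m c
  have A: "complex_of_real ((nrm (pm (star a) m c))\<^sup>2) = sp c (pm a (- m) (pm (star a) m c))" for m c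
    unfolding nrm_square(2)[symmetric] by (simp add: adjoint)
  have X: "(nrm (pm a (- m) c))\<^sup>2 = (nrm (pm (star a) m c))\<^sup>2 + Re (sp (R m c) c)" for m c
  proof -
    have "sp (pm a (- m) c) (pm a (- m) c) = sp (pm (star a) m (pm a (- m) c)) c"
      by (simp add: adjoint)
    also have "\<dots> = cnj (sp c (pm a (- m) (pm (star a) m c))) + sp (R m c) c"
      by (simp add: comm sp_linear R_def sp_cnj)
    also have "\<dots> = of_real ((nrm (pm (star a) m c))\<^sup>2) + sp (R m c) c"
      by (simp flip: A)
    finally show ?thesis by (simp add: nrm_square(1))
  qed
  have bounds: "\<exists>C s c0. C \<ge> 0 \<and> (\<forall>m\<ge>1. \<forall>n. \<forall>c\<in>Gz (int n).
        nrm (pm (star a) m c) \<le> C * (1 + of_int m + real n) ^ s * sqrt (g (n + c0)) * nrm c \<and>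
        nrm (pm a (- m) c) \<le> C * (1 + of_int m + real n) ^ s * sqrt (g (n + c0)) * nrm c)"
    if g: "growth g" and F: "\<forall>v\<in>w ` I. dominated g (\<lambda>_. pm v 0)" for g
  proof -
    have "dominated g R"
      unfolding R_def
    proof (rule dominated_sum[OF g])
      fix \<kappa> assume \<kappa>: "\<kappa> \<in> I"
      then obtain H p where "H \<ge> 0" "\<And>m. norm (f \<kappa> m) \<le> H * (1 + \<bar>of_int m\<bar>) ^ p" using I by blast
      then show "dominated g (\<lambda>m c. smul (f \<kappa> m) (pm (w \<kappa>) 0 c))"
        using F \<kappa> by (intro dominated_scale[OF g]) auto
    qed
    then obtain C s c0 where R: "C \<ge> 0" "\<And>m k c. c \<in> Gz k \<Longrightarrow>
       nrm (R m c) \<le> C * (1 + \<bar>of_int m\<bar> + \<bar>of_int k\<bar>) ^ s * g (nat k + c0) * nrm c"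
      unfolding dominated_def by blast
    have "nrm (pm (star a) m c) \<le> sqrt C * (1 + of_int m + real n) ^ (s + 1) * sqrt (g (n + c0)) * nrm c \<and>
          nrm (pm a (- m) c) \<le> sqrt C * (1 + of_int m + real n) ^ (s + 1) * sqrt (g (n + c0)) * nrm c"
      if m: "m \<ge> 1" and c: "c \<in> Gz (int n)" for m n c
    proof -
      \<comment> \<open>For fixed \<open>m\<close> the commutator bound is monotone in the degree,
        as the ladder estimate requires.\<close>
      define Q where "Q n = C * (1 + of_int m + real n) ^ s * g (n + c0)" for n
      have Q: "Q n \<ge> 0" "i \<le> j \<Longrightarrow> Q i \<le> Q j" for n i j
        using R(1) m growth_ge0[OF g] growth_mono[OF g, of "i + c0" "j + c0"]
        by (auto simp: Q_def intro!: mult_nonneg_nonneg mult_mono power_mono)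
      have step: "(nrm (pm a (- m) c))\<^sup>2 \<le> (nrm (pm (star a) m c))\<^sup>2 + Q n * (nrm c)\<^sup>2"
        if c: "c \<in> Gz (int n)" for n c
      proof -
        have "Re (sp (R m c) c) \<le> nrm (R m c) * nrm c"
          using cauchy_schwarz[of "R m c" c] complex_Re_le_cmod[of "sp (R m c) c"] by linarith
        also have "\<dots> \<le> Q n * nrm c * nrm c"
          using R(2)[OF c, of m] m by (intro mult_right_mono) (auto simp: Q_def)
        finally show ?thesis unfolding X by (simp add: power2_eq_square mult_ac)
      qed
      have adj: "(nrm (pm (star a) m c))\<^sup>2 \<le> nrm c * nrm (pm a (- m) (pm (star a) m c))" for c
        using cauchy_schwarz[of c "pm a (- m) (pm (star a) m c)"]
        unfolding A[symmetric] norm_of_real abs_power2 .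
      have le: "x \<le> sqrt C * (1 + of_int m + real n) ^ (s + 1) * sqrt (g (n + c0)) * nrm c"
        if "x\<^sup>2 \<le> real (Suc n) * Q n * (nrm c)\<^sup>2" for x
      proof (rule power2_le_imp_le)
        define Z where "Z = 1 + of_int m + real n"
        have Z: "Z \<ge> real (Suc n)" "Z \<ge> 1" using m by (auto simp: Z_def)
        have "x\<^sup>2 \<le> real (Suc n) * (C * Z ^ s * g (n + c0)) * (nrm c)\<^sup>2"
          using that by (simp add: Q_def Z_def)
        \<comment> \<open>The first \<open>Z\<close> absorbs \<open>Suc n\<close>; the factor
          \<open>Z ^ (s + 1)\<close> is spent only to make the total exponent of \<open>Z\<close>
          even, so that the bound is a square.\<close>
        also have "\<dots> \<le> (Z * Z ^ (s + 1)) * (C * Z ^ s * g (n + c0)) * (nrm c)\<^sup>2"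
        proof (intro mult_right_mono)
          have "Z * 1 \<le> Z * Z ^ (s + 1)"
            using Z by (intro mult_left_mono one_le_power) auto
          then show "real (Suc n) \<le> Z * Z ^ (s + 1)" using Z by linarith
        qed (use R(1) Z growth_ge0[OF g] in auto)
        also have "\<dots> = (sqrt C * Z ^ (s + 1) * sqrt (g (n + c0)) * nrm c)\<^sup>2"
          using R(1) growth_ge0[OF g] 
          by (simp add: power_mult_distrib power2_eq_square mult_ac)
        finally show "x\<^sup>2 \<le> (sqrt C * (1 + of_int m + real n) ^ (s + 1) * sqrt (g (n + c0)) * nrm c)\<^sup>2"
          unfolding Z_def .
      qed (use R(1) m growth_ge0[OF g] in auto)
      have L: "(nrm (pm (star a) m c))\<^sup>2 \<le> real n * Q n * (nrm c)\<^sup>2"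
        "(nrm (pm a (- m) c))\<^sup>2 \<le> real (Suc n) * Q n * (nrm c)\<^sup>2"
        using ladder_bound[of m "pm (star a) m" Q "pm a (- m)", OF m pmode_grade Q step adj c] by blast+
      have "real n * Q n * (nrm c)\<^sup>2 \<le> real (Suc n) * Q n * (nrm c)\<^sup>2"
        by (intro mult_right_mono) (use Q in auto)
      with L(1) have "(nrm (pm (star a) m c))\<^sup>2 \<le> real (Suc n) * Q n * (nrm c)\<^sup>2" by linarith
      then show ?thesis using le L(2) by blast
    qed
    then show ?thesis using R(1) by (intro exI[of _ "sqrt C"] exI[of _ "s + 1"] exI[of _ c0]) auto
  qed
  show ?thesis
  \<comment> \<open>The finite set is fixed before \<open>g\<close>, because \<open>g\<close> will
    later be built from the zero modes of such a set.\<close>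
  proof (intro exI[of _ "w ` I"] conjI allI impI)
    show "finite (w ` I)" using I by simp
    fix g assume g: "growth g" and F: "\<forall>v\<in>w ` I. dominated g (\<lambda>_. pm v 0)"
    obtain C s c0 where B: "C \<ge> 0" "\<forall>m\<ge>1. \<forall>n. \<forall>c\<in>Gz (int n).
        nrm (pm (star a) m c) \<le> C * (1 + of_int m + real n) ^ s * sqrt (g (n + c0)) * nrm c \<and>
        nrm (pm a (- m) c) \<le> C * (1 + of_int m + real n) ^ s * sqrt (g (n + c0)) * nrm c"
      using bounds[OF g F] by (elim exE conjE) (rule that)
    show "dominated (\<lambda>n. sqrt (g n)) (\<lambda>m c. if m < 0 then pm a m c else 0)"
    proof (rule dominatedI_nat[OF B(1)])
      fix m n c assume c: "c \<in> Gz (int n)"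
      show "nrm (if m < 0 then pm a m c else 0)
          \<le> C * (1 + \<bar>of_int m\<bar> + real n) ^ s * sqrt (g (n + c0)) * nrm c"
        using B(1) B(2)[rule_format, OF _ c, of "- m"] growth_ge0[OF g] by auto
    qed (simp add: pmode_hom)
    show "dominated (\<lambda>n. sqrt (g n)) (\<lambda>m c. if m > 0 then pm (star a) m c else 0)"
    proof (rule dominatedI_nat[OF B(1)])
      fix m n c assume c: "c \<in> Gz (int n)"
      show "nrm (if m > 0 then pm (star a) m c else 0)
          \<le> C * (1 + \<bar>of_int m\<bar> + real n) ^ s * sqrt (g (n + c0)) * nrm c"
        using B(1) B(2)[rule_format, OF _ c, of m] growth_ge0[OF g] by auto
    qed (simp add: pmode_hom)
  qed
qed

text \<open>The ladder estimate with \<open>L (-1)\<close> as the raising operator: the commutator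
  \<open>2 * L 0\<close> is the scalar \<open>2 * n\<close> in degree \<open>n\<close>, so no zero
  mode has to be controlled.\<close>

lemma dominated_L1: "dominated (\<lambda>_. 1) (\<lambda>_. L 1)"
proof (rule dominatedI_nat[of 2])
  fix m :: int and n c assume c: "c \<in> Gz (int n)"
  have A: "complex_of_real ((nrm (L 1 c))\<^sup>2) = sp c (L (- 1) (L 1 c))" for c
    unfolding nrm_square(2)[symmetric] by (simp add: L_adjoint)
  have "(nrm (L 1 c))\<^sup>2 \<le> real n * (2 * real n) * (nrm c)\<^sup>2"
  proof (rule ladder_bound(1)[of 1 "L 1" "\<lambda>n. 2 * real n" "L (- 1)", OF _ _ _ _ _ _ c])
    fix n c assume c: "c \<in> Gz (int n)"
    have "sp (L (- 1) c) (L (- 1) c) = sp (L 1 (L (- 1) c)) c"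
      by (simp add: L_adjoint)
    also have "\<dots> = cnj (sp c (L (- 1) (L 1 c))) + 2 * (of_nat n * sp c c)"
      using c by (simp add: virasoro(2) sp_linear Gz_def sp_cnj)
    finally have "sp (L (- 1) c) (L (- 1) c) = of_real ((nrm (L 1 c))\<^sup>2) + 2 * (of_nat n * sp c c)"
      by (simp flip: A)
    then show "(nrm (L (- 1) c))\<^sup>2 \<le> (nrm (L 1 c))\<^sup>2 + 2 * real n * (nrm c)\<^sup>2"
      by (simp add: nrm_square(1))
  next
    fix c show "(nrm (L 1 c))\<^sup>2 \<le> nrm c * nrm (L (- 1) (L 1 c))"
      using cauchy_schwarz[of c "L (- 1) (L 1 c)"]
      unfolding A[symmetric] norm_of_real abs_power2 .
  qed (auto intro: L_grade)
  also have "\<dots> \<le> (2 * (1 + \<bar>of_int m\<bar> + real n) * nrm c)\<^sup>2"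
  proof -
    have "real n * (2 * real n) \<le> (2 * (1 + \<bar>of_int m\<bar> + real n))\<^sup>2"
      unfolding power2_eq_square by (intro mult_mono) auto
    then show ?thesis unfolding power_mult_distrib[of _ "nrm c"] by (intro mult_right_mono) auto
  qed
  finally have "nrm (L 1 c) \<le> 2 * (1 + \<bar>of_int m\<bar> + real n) * nrm c"
    by (rule power2_le_imp_le) simp
  then show "nrm (L 1 c) \<le> 2 * (1 + \<bar>of_int m\<bar> + real n) ^ 1 * 1 * nrm c" by simp
qed (auto simp: L_linear)

text \<open>Induction on the degree: the zero mode of \<open>a\<close> reduces to its mode
  \<open>-1\<close> and to the zero mode of \<open>L 1 a\<close>, which has degree one less. In
  degree \<open>0\<close> only multiples of the vacuum occur, and these need no control.\<close>

lemma dominated_all_modes: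
  assumes "a \<in> Gz (int d)"
  shows "\<exists>F. finite F \<and> (\<forall>g. growth g \<longrightarrow> (\<forall>w\<in>F. dominated g (\<lambda>_. pm w 0)) \<longrightarrow> dominated (\<lambda>n. sqrt (g n)) (Y a))"
  using assms
proof (induction d arbitrary: a)
  case 0
  have "a \<in> span {vac}" using 0 VOA by (simp add: is_VOA_def Vgr_eq)
  then obtain x where a: "a = smul x vac" by (auto simp: span_singleton)
  have Y: "Y a m c = smul x (if m = -1 then c else 0)" for m c
    using VOA by (simp add: a is_VOA_def Y_scale_left)
  show ?case
  proof (intro exI[of _ "{}"] conjI allI impI)
    fix g assume g: "growth g"
    have "dominated (\<lambda>n. sqrt (g n)) (\<lambda>_ c. c)"
    proof (rule dominatedI[of 1 _ 0 _ 0])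
      fix k c show "nrm c \<le> 1 * (1 + \<bar>of_int (m::int)\<bar> + \<bar>of_int k\<bar>) ^ 0 * sqrt (g (nat k + 0)) * nrm c" for m
        using mult_right_mono[of 1 "sqrt (g (nat k))" "nrm c"] growth_ge1[OF g, of "nat k"] by simp
    qed simp
    then show "dominated (\<lambda>n. sqrt (g n)) (Y a)"
      by (rule dominated_le[OF dominated_smul[OF growth_sqrt[OF g], of _ x]]) (simp add: Y)
  qed simp
next
  case (Suc d)
  have a: "a \<in> Gz (int (Suc d))" by fact
  have "L 1 a \<in> Gz (int d)" by (rule L_grade[OF a]) simp
  from Suc.IH[OF this] obtain F1 where F1: "finite F1"
    "\<forall>g. growth g \<longrightarrow> (\<forall>w\<in>F1. dominated g (\<lambda>_. pm w 0)) \<longrightarrow> dominated (\<lambda>n. sqrt (g n)) (Y (L 1 a))"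
    by (elim exE conjE) (rule that)
  obtain F2 where F2: "finite F2"
    "\<forall>g. growth g \<longrightarrow> (\<forall>w\<in>F2. dominated g (\<lambda>_. pm w 0)) \<longrightarrow>
      dominated (\<lambda>n. sqrt (g n)) (\<lambda>m c. if m < 0 then pm a m c else 0) \<and>
      dominated (\<lambda>n. sqrt (g n)) (\<lambda>m c. if m > 0 then pm (star a) m c else 0)"
    using dominated_nonzero_modes[of a] by (elim exE conjE) (rule that)
  \<comment> \<open>Starting from \<open>star a\<close>, the second half concerns
    \<open>star (star a) = a\<close> and yields the positive modes of \<open>a\<close>.\<close>
  obtain F3 where F3: "finite F3"
    "\<forall>g. growth g \<longrightarrow> (\<forall>w\<in>F3. dominated g (\<lambda>_. pm w 0)) \<longrightarrow>
      dominated (\<lambda>n. sqrt (g n)) (\<lambda>m c. if m < 0 then pm (star a) m c else 0) \<and>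
      dominated (\<lambda>n. sqrt (g n)) (\<lambda>m c. if m > 0 then pm a m c else 0)"
    using dominated_nonzero_modes[of "star a"] unfolding star_star by (elim exE conjE) (rule that)
  show ?case
  proof (intro exI[of _ "F1 \<union> F2 \<union> F3"] conjI allI impI)
    fix g assume g': "growth g" and F: "\<forall>w\<in>F1 \<union> F2 \<union> F3. dominated g (\<lambda>_. pm w 0)"
    define h where "h n = sqrt (g n)" for n
    have h: "growth h" unfolding h_def by (rule growth_sqrt[OF g'])
    have L1: "dominated h (Y (L 1 a))" and neg: "dominated h (\<lambda>m c. if m < 0 then pm a m c else 0)"
      and pos: "dominated h (\<lambda>m c. if m > 0 then pm a m c else 0)"
      unfolding h_def using F1 F2 F3 F g' by auto
    have pmY: "pm a m = Y a (m + int d)" for m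
      using pmode_homogeneous[OF a] by (auto simp: algebra_simps)
    have m1: "dominated h (\<lambda>_. pm a (-1))"
      using dominated_const[OF h neg, of "-1"] by simp
    \<comment> \<open>\<open>L 1\<close> is polynomially bounded, so commuting with it does not
      alter the growth function.\<close>
    have "dominated h (\<lambda>_. pm a 0)"
    proof -
      have 1: "dominated h (\<lambda>_ c. L 1 (pm a (-1) c))"
      proof (rule dominated_comp[OF growth_one h h dominated_L1 m1, where \<sigma> = "\<lambda>_. 1" and e = 1])
        show "pm a (-1) c \<in> Gz (k + 1)" if "c \<in> Gz k" for k c
          using pmode_grade[OF that, of a "-1"] by simp
      qed auto
      have 2: "dominated h (\<lambda>_ c. pm a (-1) (L 1 c))"
      proof (rule dominated_comp[OF h growth_one h m1 dominated_L1, where \<sigma> = "\<lambda>_. -1" and e = 1])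
        show "L 1 c \<in> Gz (k + - 1)" if "c \<in> Gz k" for k c
          using L_grade[OF that] by simp
        show "\<exists>c1. \<forall>(m::int) n. h (nat (n + - 1) + c0) * 1 \<le> h (nat n + c1)" for c0
          by (intro exI[of _ c0]) (auto intro!: growth_mono[OF h])
      qed auto
      have 3: "dominated h (\<lambda>_. Y (L 1 a) (int d - 1))" by (rule dominated_const[OF h L1])
      have "dominated h (\<lambda>_ c. smul (1 / of_int (int (Suc d)))
          (L 1 (pm a (-1) c) - pm a (-1) (L 1 c) - Y (L 1 a) (int d - 1) c))"
        by (intro dominated_smul[OF h] dominated_diff[OF h] 1 2 3)
      then show ?thesis
      proof (rule dominated_le)
        fix c
        have "smul (of_int (int (Suc d))) (pm a 0 c)
            = L 1 (pm a (-1) c) - pm a (-1) (L 1 c) - Y (L 1 a) (int d - 1) c"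
          using L1_commutator[OF a, of c] by (simp add: pmY algebra_simps)
        from this[symmetric] show "nrm (pm a 0 c) \<le> nrm (smul (1 / of_int (int (Suc d)))
          (L 1 (pm a (-1) c) - pm a (-1) (L 1 c) - Y (L 1 a) (int d - 1) c))"
          by (simp del: of_nat_Suc)
      qed
    qed
    from dominated_if[OF h pos dominated_if[OF h neg this, of "\<lambda>m. m < 0"], of "\<lambda>m. m > 0"]
    have "dominated h (pm a)"
    proof (rule dominated_le)
      show "nrm (pm a m c) \<le> nrm (if m > 0 then if m > 0 then pm a m c else 0
          else if m < 0 then if m < 0 then pm a m c else 0 else pm a 0 c)" for m c
        by (cases m "0::int" rule: linorder_cases) auto
    qed
    from dominated_shift[OF h this, of "- int d"] show "dominated (\<lambda>n. sqrt (g n)) (Y a)"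
      by (simp add: pmY h_def[abs_def])
  qed (use F1 F2 F3 in auto)
qed


section \<open>Common constants and iterated modes\<close>

lemma dominated_uniform:
  assumes g: "growth g" and "finite F" "\<And>w. w \<in> F \<Longrightarrow> dominated g (T w)"
  shows "\<exists>C s c0. C \<ge> 0 \<and> (\<forall>w\<in>F. \<forall>m k. \<forall>c\<in>Gz k.
     nrm (T w m c) \<le> C * (1 + \<bar>of_int m\<bar> + \<bar>of_int k\<bar>) ^ s * g (nat k + c0) * nrm c)"
  using assms(2,3)
proof (induction F rule: finite_induct)
  case (insert v F)
  obtain C s c0 where 1: "C \<ge> 0" "\<forall>w\<in>F. \<forall>m k. \<forall>c\<in>Gz k.
     nrm (T w m c) \<le> C * (1 + \<bar>of_int m\<bar> + \<bar>of_int k\<bar>) ^ s * g (nat k + c0) * nrm c"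
    using insert by auto
  obtain C' s' c0' where 2: "C' \<ge> 0" "\<forall>m k. \<forall>c\<in>Gz k.
     nrm (T v m c) \<le> C' * (1 + \<bar>of_int m\<bar> + \<bar>of_int k\<bar>) ^ s' * g (nat k + c0') * nrm c"
    using insert.prems[of v] unfolding dominated_def by auto
  have "nrm (T w m c) \<le> (C + C') * (1 + \<bar>of_int m\<bar> + \<bar>of_int k\<bar>) ^ (s + s') * g (nat k + (c0 + c0')) * nrm c"
    if w: "w \<in> insert v F" and c: "c \<in> Gz k" for w m k c
  proof (cases "w = v")
    case True
    show ?thesis
      unfolding True by (rule order_trans[OF 2(2)[rule_format, OF c] dominated_weaken[OF g]]) (use 1 2 in auto)
  next
    case False
    then have "w \<in> F" using w by simp
    show ?thesis
      by (rule order_trans[OF 1(2)[rule_format, OF \<open>w \<in> F\<close> c] dominated_weaken[OF g]]) (use 1 2 in auto)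
  qed
  then show ?case using 1 2 by (intro exI[of _ "C + C'"] exI[of _ "s + s'"] exI[of _ "c0 + c0'"]) auto
qed (auto intro: exI[of _ 0])

text \<open>Each term of the associator formula contains one mode of \<open>u\<close> and one of
  \<open>a\<close>, so \<open>g\<close> enters only once, at a degree shifted by a constant. The
  grading makes all terms with large \<open>i\<close> vanish, and the number of remaining terms and
  their coefficients are polynomial in \<open>q\<close> and \<open>n\<close>.\<close>

lemma dominated_iterate:
  assumes g: "growth g" and u: "u \<in> Gz e" "dominated (\<lambda>_. 1) (Y u)" and a: "a \<in> Gz d" "dominated g (Y a)"
  shows "dominated g (Y (Y u k a))"
proof -
  obtain Cu su where Bu: "Cu \<ge> 0" "\<And>m j c. c \<in> Gz j \<Longrightarrow>
     nrm (Y u m c) \<le> Cu * (1 + \<bar>of_int m\<bar> + \<bar>of_int j\<bar>) ^ su * 1 * nrm c"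
    using u(2) unfolding dominated_def by blast
  obtain Ca sa ca where Ba: "Ca \<ge> 0" "\<And>m j c. c \<in> Gz j \<Longrightarrow>
     nrm (Y a m c) \<le> Ca * (1 + \<bar>of_int m\<bar> + \<bar>of_int j\<bar>) ^ sa * g (nat j + ca) * nrm c"
    using a(2) unfolding dominated_def by blast
  obtain K where K: "K \<ge> 0" "\<And>i. norm ((of_int k :: complex) gchoose i) \<le> K * (1 + real i) ^ nat \<bar>k\<bar>"
    by (rule gbinomial_int_norm_le[of k]) (rule that)
  \<comment> \<open>The factor \<open>4\<close> makes \<open>\<Lambda> * X\<close> an upper bound
    for all mode and degree expressions below as long as \<open>i < B\<close>.\<close>
  define \<Lambda> where "\<Lambda> = 4 * (1 + \<bar>real_of_int d\<bar> + \<bar>real_of_int e\<bar> + \<bar>real_of_int k\<bar>)"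
  \<comment> \<open>The exponent collects the binomial coefficient, the bounds for \<open>u\<close>
    and \<open>a\<close>, and one more power for the number of terms.\<close>
  define p where "p = nat \<bar>k\<bar> + (su + sa) + 1"
  show ?thesis
  proof (rule dominatedI_nat[of "2 * K * Cu * Ca * \<Lambda> ^ p"])
    fix q n c assume c: "c \<in> Gz (int n)"
    define X where "X = 1 + \<bar>real_of_int q\<bar> + real n"
    define E where "E = \<Lambda> * X"
    have "(\<bar>real_of_int d\<bar> + \<bar>real_of_int e\<bar> + \<bar>real_of_int k\<bar>) * X \<ge> (\<bar>real_of_int d\<bar> + \<bar>real_of_int e\<bar> + \<bar>real_of_int k\<bar>) * 1"
      by (intro mult_left_mono) (auto simp: X_def)
    then have E: "E \<ge> 4 * X + 4 * (\<bar>real_of_int d\<bar> + \<bar>real_of_int e\<bar> + \<bar>real_of_int k\<bar>)"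
      by (simp add: E_def \<Lambda>_def algebra_simps)
    have E1: "E \<ge> 1" using E by (simp add: X_def)
    \<comment> \<open>From \<open>i = B\<close> on, \<open>Y a (q + i) c\<close> and
      \<open>Y u i c\<close> both have negative degree.\<close>
    define B where "B = n + nat \<bar>d\<bar> + nat \<bar>e\<bar> + nat \<bar>q\<bar> + 1"
    \<comment> \<open>For \<open>i \<ge> 0\<close> the mode \<open>Y u i\<close> changes the degree
      by at most \<open>e - 1\<close>, whence the shift in the argument of \<open>g\<close>.\<close>
    define G where "G = g (n + (nat \<bar>e\<bar> + ca))"
    define \<tau> where "\<tau> i = smul ((-1) ^ i * (of_int k gchoose i))
      (Y u (k - int i) (Y a (q + int i) c)
       - smul ((-1) powi k) (Y a (q + k - int i) (Y u (int i) c)))" for i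
    have ac: "Y a (q + int i) c \<in> Gz (int n + d - (q + int i) - 1)" for i
      by (rule Y_grade[OF a(1) c refl])
    have uc: "Y u (int i) c \<in> Gz (int n + e - int i - 1)" for i
      by (rule Y_grade[OF u(1) c refl])
    have \<tau>0: "\<tau> i = 0" if "i \<ge> B" for i
    proof -
      have "Y a (q + int i) c = 0" by (rule Gz_neg[OF ac]) (use that in \<open>auto simp: B_def\<close>)
      moreover have "Y u (int i) c = 0" by (rule Gz_neg[OF uc]) (use that in \<open>auto simp: B_def\<close>)
      ultimately show ?thesis by (simp add: \<tau>_def Y_zero)
    qed
    obtain N where N: "\<And>M. M \<ge> N \<Longrightarrow> Y (Y u k a) q c = (\<Sum>i<M. \<tau> i)"
      using Y_associator[of u k a q c] unfolding \<tau>_def by blast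
    have "Y (Y u k a) q c = (\<Sum>i<max N B. \<tau> i)" by (rule N) simp
    also have "\<dots> = (\<Sum>i<B. \<tau> i)"
      by (rule sum.mono_neutral_right) (auto intro: \<tau>0)
    finally have "nrm (Y (Y u k a) q c) \<le> (\<Sum>i<B. nrm (\<tau> i))" using nrm_sum by simp
    also have "\<dots> \<le> (\<Sum>i<B. K * E ^ nat \<bar>k\<bar> * (2 * (Cu * Ca * E ^ (su + sa) * G * nrm c)))"
    proof (rule sum_mono)
      fix i assume "i \<in> {..<B}"
      then have i: "real i \<le> real n + \<bar>real_of_int d\<bar> + \<bar>real_of_int e\<bar> + \<bar>real_of_int q\<bar>"
        unfolding B_def by simp
      have g0: "g j \<ge> 0" for j by (rule growth_ge0[OF g])
      have 1: "nrm (Y u (k - int i) (Y a (q + int i) c)) \<le> Cu * Ca * E ^ (su + sa) * G * nrm c"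
      proof -
        have "nrm (Y u (k - int i) (Y a (q + int i) c)) \<le>
          Cu * (1 + \<bar>of_int (k - int i)\<bar> + \<bar>of_int (int n + d - (q + int i) - 1)\<bar>) ^ su * 1
            * nrm (Y a (q + int i) c)" by (rule Bu(2)[OF ac])
        also have "\<dots> \<le> Cu * E ^ su * 1 * nrm (Y a (q + int i) c)"
          by (rule dominated_weaken[OF growth_one]) (use Bu(1) i E in \<open>auto simp: X_def\<close>)
        also have "\<dots> \<le> Cu * E ^ su * 1 * (Ca * (1 + \<bar>of_int (q + int i)\<bar> + \<bar>of_int (int n)\<bar>) ^ sa
            * g (nat (int n) + ca) * nrm c)"
          using Bu(1) E1 by (intro mult_left_mono Ba(2)[OF c]) auto
        also have "\<dots> \<le> Cu * E ^ su * 1 * (Ca * E ^ sa * G * nrm c)"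
          unfolding G_def
          by (intro mult_left_mono dominated_weaken[OF g]) (use Bu(1) Ba(1) E1 i E in \<open>auto simp: X_def\<close>)
        finally show ?thesis by (simp add: power_add mult_ac)
      qed
      have 2: "nrm (Y a (q + k - int i) (Y u (int i) c)) \<le> Cu * Ca * E ^ (su + sa) * G * nrm c"
      proof -
        have "nrm (Y a (q + k - int i) (Y u (int i) c)) \<le>
          Ca * (1 + \<bar>of_int (q + k - int i)\<bar> + \<bar>of_int (int n + e - int i - 1)\<bar>) ^ sa
            * g (nat (int n + e - int i - 1) + ca) * nrm (Y u (int i) c)" by (rule Ba(2)[OF uc])
        also have "\<dots> \<le> Ca * E ^ sa * G * nrm (Y u (int i) c)"
          unfolding G_def
        proof (rule dominated_weaken[OF g])
          show "nat (int n + e - int i - 1) + ca \<le> n + (nat \<bar>e\<bar> + ca)" by linarith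
        qed (use Ba(1) i E in \<open>auto simp: X_def\<close>)
        also have "\<dots> \<le> Ca * E ^ sa * G * (Cu * (1 + \<bar>of_int (int i)\<bar> + \<bar>of_int (int n)\<bar>) ^ su * 1 * nrm c)"
          using Ba(1) E1 g0 by (intro mult_left_mono Bu(2)[OF c]) (auto simp: G_def)
        also have "\<dots> \<le> Ca * E ^ sa * G * (Cu * E ^ su * 1 * nrm c)"
          by (intro mult_left_mono dominated_weaken[OF growth_one])
            (use Bu(1) Ba(1) E1 i E g0 in \<open>auto simp: X_def G_def\<close>)
        finally show ?thesis by (simp add: power_add mult_ac)
      qed
      have "nrm (Y u (k - int i) (Y a (q + int i) c)
         - smul ((-1) powi k) (Y a (q + k - int i) (Y u (int i) c)))
        \<le> nrm (Y u (k - int i) (Y a (q + int i) c)) + nrm (Y a (q + k - int i) (Y u (int i) c))"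
        using nrm_diff[of "Y u (k - int i) (Y a (q + int i) c)"
            "smul ((-1) powi k) (Y a (q + k - int i) (Y u (int i) c))"]
        by (simp add: nrm_scale norm_power_int)
      then have 3: "nrm (Y u (k - int i) (Y a (q + int i) c)
         - smul ((-1) powi k) (Y a (q + k - int i) (Y u (int i) c)))
        \<le> 2 * (Cu * Ca * E ^ (su + sa) * G * nrm c)" using 1 2 by linarith
      have "norm ((-1) ^ i * ((of_int k :: complex) gchoose i)) \<le> K * (1 + real i) ^ nat \<bar>k\<bar>"
        using K(2)[of i] by (simp add: norm_mult norm_power)
      also have "\<dots> \<le> K * E ^ nat \<bar>k\<bar>"
        using K(1) i E by (intro mult_left_mono power_mono) (auto simp: X_def)
      finally show "nrm (\<tau> i) \<le> K * E ^ nat \<bar>k\<bar> * (2 * (Cu * Ca * E ^ (su + sa) * G * nrm c))"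
        unfolding \<tau>_def nrm_scale using K(1) E1 by (intro mult_mono 3) auto
    qed
    also have "\<dots> = real B * (K * E ^ nat \<bar>k\<bar> * (2 * (Cu * Ca * E ^ (su + sa) * G * nrm c)))"
      by simp
    also have "\<dots> \<le> E * (K * E ^ nat \<bar>k\<bar> * (2 * (Cu * Ca * E ^ (su + sa) * G * nrm c)))"
    proof (rule mult_right_mono)
      show "real B \<le> E" using E by (simp add: B_def X_def)
    qed (use K(1) E1 Bu(1) Ba(1) growth_ge0[OF g] in \<open>auto simp: G_def\<close>)
    also have "\<dots> = 2 * K * Cu * Ca * E ^ p * G * nrm c"
      by (simp add: p_def power_add mult_ac)
    finally show "nrm (Y (Y u k a) q c)
        \<le> 2 * K * Cu * Ca * \<Lambda> ^ p * (1 + \<bar>of_int q\<bar> + real n) ^ p * g (n + (nat \<bar>e\<bar> + ca)) * nrm c"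
      by (simp add: E_def G_def X_def power_mult_distrib mult_ac)
  qed (use K(1) Bu(1) Ba(1) in \<open>auto simp: Y_zero \<Lambda>_def\<close>)
qed

section \<open>Passage between operator norms and degreewise bounds\<close>

lemma pmode_sum: "pm a n (\<Sum>i\<in>I. f i) = (\<Sum>i\<in>I. pm a n (f i))"
  by (induction I rule: infinite_finite_induct) (auto simp: pmode_hom)

text \<open>Rescale \<open>c\<close> to norm one. \<open>W\<close> need only contain the line
  through \<open>c\<close>, so the rule serves for \<open>Vle\<close> as well as for a single
  \<open>Gz\<close>.\<close>

lemma nrm_le_by_scaling:
  assumes T: "\<And>x b. T (smul x b) = smul x (T b)"
    and c: "\<And>x. smul x c \<in> W" and le: "\<And>b. b \<in> W \<Longrightarrow> nrm b \<le> 1 \<Longrightarrow> nrm (T b) \<le> B"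
  shows "nrm (T c) \<le> B * nrm c"
proof (cases "c = 0")
  case True
  then show ?thesis using T[of 0 0] by simp
next
  case False
  then have n: "nrm c > 0" by (rule nrm_pos)
  have "nrm (T (smul (1 / of_real (nrm c)) c)) \<le> B"
    by (rule le[OF c]) (use n in \<open>simp add: nrm_scale norm_divide\<close>)
  then show ?thesis using n by (simp add: T nrm_scale norm_divide field_simps)
qed

text \<open>Vectors of degree \<open>n\<close> lie in \<open>Vle\<close> at \<open>n\<close>, and
  the real exponents may be rounded up to natural numbers because the bases are at least
  \<open>1\<close>.\<close>

lemma energy_bounds_imp_dom:
  assumes "energy_bounds smul Y cv sp a"
  shows "dominated (\<lambda>_. 1) (pm a)"
proof -
  obtain s C t where st: "s \<ge> 0" "C \<ge> 0" "t \<ge> 0" and le: "\<And>m n::int. opnorm_n smul Y cv sp (pm a m) n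
        \<le> ennreal (C * (1 + real_of_int \<bar>m\<bar>) powr t * (1 + real_of_int \<bar>n\<bar>) powr s)"
    using assms unfolding energy_bounds_def by blast
  have powr_le: "x powr y \<le> x ^ nat \<lceil>y\<rceil>" if "x \<ge> 1" "y \<ge> 0" for x y :: real
  proof -
    have "x powr y \<le> x powr real (nat \<lceil>y\<rceil>)" using that by (intro powr_mono) linarith+
    also have "\<dots> = x ^ nat \<lceil>y\<rceil>" using that by (intro powr_realpow) simp
    finally show ?thesis .
  qed
  show ?thesis
  proof (rule dominatedI_nat[OF st(2)])
    fix m n c assume c: "c \<in> Gz (int n)"
    let ?B = "C * (1 + real_of_int \<bar>m\<bar>) powr t * (1 + real_of_int \<bar>int n\<bar>) powr s"
    have "nrm (pm a m c) \<le> ?B * nrm c"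
    proof (rule nrm_le_by_scaling[where W = "Vle smul Y cv (int n)"])
      show "smul x c \<in> Vle smul Y cv (int n)" for x
        unfolding Vle_def using c by (intro span_scale span_base) (auto simp: Vgr_eq)
    next
      fix b assume "b \<in> Vle smul Y cv (int n)" "nrm b \<le> 1"
      then have "ennreal (nrm (pm a m b)) \<le> opnorm_n smul Y cv sp (pm a m) (int n)"
        unfolding opnorm_n_def by (intro SUP_upper) auto
      also have "\<dots> \<le> ennreal ?B" by (rule le)
      finally show "nrm (pm a m b) \<le> ?B" using st by (simp add: ennreal_le_iff)
    qed (rule pmode_hom)
    also have "?B \<le> C * ((1 + \<bar>of_int m\<bar> + real n) ^ nat \<lceil>t\<rceil> * (1 + \<bar>of_int m\<bar> + real n) ^ nat \<lceil>s\<rceil>)"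
    proof -
      have "(1 + real_of_int \<bar>m\<bar>) powr t \<le> (1 + \<bar>of_int m\<bar> + real n) ^ nat \<lceil>t\<rceil>"
        using st by (intro order_trans[OF powr_le] power_mono) auto
      moreover have "(1 + real_of_int \<bar>int n\<bar>) powr s \<le> (1 + \<bar>of_int m\<bar> + real n) ^ nat \<lceil>s\<rceil>"
        using st by (intro order_trans[OF powr_le] power_mono) auto
      ultimately show ?thesis using st unfolding mult.assoc by (intro mult_left_mono mult_mono) auto
    qed
    finally show "nrm (pm a m c) \<le> C * (1 + \<bar>of_int m\<bar> + real n) ^ (nat \<lceil>t\<rceil> + nat \<lceil>s\<rceil>) * 1 * nrm c"
      by (simp add: power_add mult_right_mono)
  qed (simp add: pmode_hom)
qed

lemma dominated_pmode:
  assumes g: "growth g" and "\<And>d. dominated g (Y (cmp d a))"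
  shows "dominated g (pm a)"
proof -
  have "dominated g (\<lambda>m c. \<Sum>d | cmp d a \<noteq> 0. Y (cmp d a) (m + (int d - 1)) c)"
    by (intro dominated_sum[OF g] dominated_shift[OF g] assms)
  moreover have "pm a = (\<lambda>m c. \<Sum>d | cmp d a \<noteq> 0. Y (cmp d a) (m + (int d - 1)) c)"
    by (intro ext) (simp add: pmode_def algebra_simps)
  ultimately show ?thesis by simp
qed

text \<open>A vector of energy at most \<open>n\<close> has at most \<open>1 + \<bar>n\<bar>\<close>
  components, none longer than the vector itself. Summing over them costs one power of
  \<open>1 + \<bar>n\<bar>\<close>, whence the exponent \<open>s + 1\<close>.\<close>

lemma dominated_imp_energy_bounds:
  assumes "dominated (\<lambda>_. 1) (pm a)"
  shows "energy_bounds smul Y cv sp a"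
proof -
  obtain C s where C: "C \<ge> 0" and le: "\<And>m k c. c \<in> Gz k \<Longrightarrow>
     nrm (pm a m c) \<le> C * (1 + \<bar>of_int m\<bar> + \<bar>of_int k\<bar>) ^ s * 1 * nrm c"
    using assms unfolding dominated_def by blast
  have "nrm (pm a m b) \<le> C * (1 + real_of_int \<bar>m\<bar>) powr real s * (1 + real_of_int \<bar>n\<bar>) powr real (s + 1)"
    if b: "b \<in> Vle smul Y cv n" "nrm b \<le> 1" for m n b
  proof -
    obtain I f where f: "finite I" "I \<subseteq> {k. int k \<le> n}" "\<And>k. f k \<in> Vgr smul Y cv k" "b = (\<Sum>k\<in>I. f k)"
      using span_graded[OF b(1)[unfolded Vle_def]] by blast
    let ?B = "C * ((1 + \<bar>of_int m\<bar>) * (1 + \<bar>of_int n\<bar>)) ^ s"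
    have "nrm (pm a m b) \<le> (\<Sum>k\<in>I. nrm (pm a m (f k)))"
      unfolding f(4) pmode_sum by (rule nrm_sum)
    also have "\<dots> \<le> (\<Sum>k\<in>I. ?B)"
    proof (rule sum_mono)
      fix k assume k: "k \<in> I"
      have "nrm (f k) \<le> 1"
        using nrm_component_le[OF f(1), of f k] f(3) b(2) k unfolding Vgr_eq f(4)[symmetric] by force
      have kn: "real k \<le> \<bar>of_int n\<bar>" using f(2) k by fastforce
      have "nrm (pm a m (f k)) \<le> C * (1 + \<bar>of_int m\<bar> + \<bar>of_int (int k)\<bar>) ^ s * 1 * nrm (f k)"
        using f(3) by (intro le) (simp add: Vgr_eq)
      also have "\<dots> \<le> C * (1 + \<bar>of_int m\<bar> + \<bar>of_int (int k)\<bar>) ^ s * 1 * 1"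
        using C by (intro mult_left_mono \<open>nrm (f k) \<le> 1\<close>) auto
      also have "\<dots> \<le> ?B"
      proof -
        have "1 + \<bar>of_int m\<bar> + \<bar>of_int (int k)\<bar> \<le> (1 + \<bar>of_int m\<bar>) * (1 + \<bar>real_of_int n\<bar>)"
          using kn mult_nonneg_nonneg[of "\<bar>real_of_int m\<bar>" "\<bar>real_of_int n\<bar>"]
          unfolding distrib_left distrib_right by linarith
        then show ?thesis using C by (auto intro!: mult_left_mono power_mono)
      qed
      finally show "nrm (pm a m (f k)) \<le> ?B" .
    qed
    also have "\<dots> = real (card I) * ?B" by simp
    also have "\<dots> \<le> (1 + \<bar>of_int n\<bar>) * ?B"
    proof (rule mult_right_mono)
      have "I \<subseteq> {..nat \<bar>n\<bar>}" using f(2) by auto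
      then have "card I \<le> card {..nat \<bar>n\<bar>}" by (intro card_mono) auto
      then show "real (card I) \<le> 1 + \<bar>of_int n\<bar>" by simp
    qed (use C in auto)
    also have "\<dots> = C * (1 + real_of_int \<bar>m\<bar>) powr real s * (1 + real_of_int \<bar>n\<bar>) powr real (s + 1)"
      by (simp only: powr_realpow add_pos_nonneg zero_less_one abs_ge_zero of_int_abs)
        (simp add: power_mult_distrib mult_ac)
    finally show ?thesis .
  qed
  then have "opnorm_n smul Y cv sp (pm a m) n
      \<le> ennreal (C * (1 + real_of_int \<bar>m\<bar>) powr real s * (1 + real_of_int \<bar>n\<bar>) powr real (s + 1))" for m n
    unfolding opnorm_n_def by (intro SUP_least ennreal_leI) auto
  then show ?thesis
    unfolding energy_bounds_def using C
    by (intro exI[of _ "real (s + 1)"] exI[of _ C] exI[of _ "real s"]) auto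
qed

text \<open>On degree \<open>n\<close> the operator \<open>qL0\<close> is the scalar
  \<open>q ^ n\<close>, so the zero mode has norm at most \<open>K / q ^ n\<close> there;
  \<open>R\<close> is raised to at least \<open>1\<close> so that the bound is monotone in
  \<open>n\<close>.\<close>

lemma exp_energy_bounded_zero_mode:
  assumes "exp_energy_bounded smul Y cv sp"
  obtains K R where "K \<ge> 0" "R \<ge> 1" "\<And>n c. c \<in> Gz (int n) \<Longrightarrow> nrm (pm w 0 c) \<le> K * R ^ n * nrm c"
proof -
  obtain q where q: "q > 0" "opnorm sp (\<lambda>b. pm w 0 (qL0 smul Y cv q b)) < \<infinity>"
    using assms unfolding exp_energy_bounded_def by blast
  define K where "K = enn2real (opnorm sp (\<lambda>b. pm w 0 (qL0 smul Y cv q b)))"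
  define R where "R = max 1 (1 / q)"
  have K: "nrm (pm w 0 (qL0 smul Y cv q b)) \<le> K" if "nrm b \<le> 1" for b
  proof -
    have "ennreal (nrm (pm w 0 (qL0 smul Y cv q b))) \<le> opnorm sp (\<lambda>b. pm w 0 (qL0 smul Y cv q b))"
      unfolding opnorm_def by (rule SUP_upper2[of b]) (use that in auto)
    also have "\<dots> = ennreal K" using q(2) by (simp add: K_def ennreal_enn2real_if less_top[symmetric])
    finally show ?thesis by (simp add: ennreal_le_iff K_def)
  qed
  have "nrm (pm w 0 c) \<le> K * R ^ n * nrm c" if c: "c \<in> Gz (int n)" for n c
  proof -
    have qL: "qL0 smul Y cv q b = smul (of_real (q ^ n)) b" if b: "b \<in> Gz (int n)" for b
    proof (cases "b = 0")
      case True
      then show ?thesis using comp_homogeneous[OF b] by (simp add: qL0_def)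
    next
      case False
      then have "{d. cmp d b \<noteq> 0} = {n}" using comp_homogeneous[OF b] by auto
      then show ?thesis using comp_homogeneous[OF b] by (simp add: qL0_def)
    qed
    have "nrm (smul (of_real (q ^ n)) (pm w 0 c)) \<le> K * nrm c"
    proof (rule nrm_le_by_scaling[where W = "Gz (int n)"])
      show "smul x c \<in> Gz (int n)" for x using c subspace_scale[OF subspace_Gz] by blast
    next
      fix b assume "b \<in> Gz (int n)" "nrm b \<le> 1"
      then show "nrm (smul (of_real (q ^ n)) (pm w 0 b)) \<le> K"
        using K[of b] by (simp add: qL pmode_hom)
    qed (simp add: pmode_hom scale_left_commute)
    then have "nrm (pm w 0 c) \<le> K * (1 / q) ^ n * nrm c"
      using q(1) by (simp add: nrm_scale norm_power field_simps)
    also have "\<dots> \<le> K * R ^ n * nrm c"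
      using q(1) by (intro mult_right_mono mult_left_mono power_mono) (auto simp: R_def K_def)
    finally show ?thesis .
  qed
  then show ?thesis by (intro that[of K R]) (auto simp: K_def R_def)
qed


subsection \<open>Extensions of energy-bounded subalgebras\<close>

lemma comp_in_subalgebra:
  assumes U: "unitary_subalgebra smul Y vac cv star U" and u: "u \<in> U"
  shows "cmp d u \<in> U"
proof (cases "cmp d u = 0")
  case True
  then show ?thesis using U subspace_0 by (simp add: unitary_subalgebra_def)
next
  case False
  have "cmp (nat (int d)) u \<in> U"
  proof (rule eigen_components[of U "int ` {d. cmp d u \<noteq> 0}" "\<lambda>k. cmp (nat k) u"])
    have "(\<Sum>i\<in>int ` {d. cmp d u \<noteq> 0}. cmp (nat i) u) = (\<Sum>d | cmp d u \<noteq> 0. cmp d u)"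
      by (rule sum_int_image[symmetric])
    then show "(\<Sum>i\<in>int ` {d. cmp d u \<noteq> 0}. cmp (nat i) u) \<in> U"
      using comp_decomposition(3)[of u, symmetric] u by (simp only:)
  qed (use U False comp_decomposition in \<open>auto simp: unitary_subalgebra_def\<close>)
  then show ?thesis by simp
qed

text \<open>The spanning vectors are homogeneous because the iterate estimate needs a degree for its
  second argument; elements of the span are again dominated but need not be homogeneous.\<close>

definition bounded_span :: "(nat \<Rightarrow> real) \<Rightarrow> 'v set" where
  "bounded_span g = span {x. \<exists>d. x \<in> Gz d \<and> dominated g (Y x)}"

lemma bounded_span_dom:
  assumes g: "growth g" and "x \<in> bounded_span g"
  shows "dominated g (Y x)"
  using assms(2) unfolding bounded_span_def
proof (induction rule: span_induct_alt)
  case base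
  have "Y 0 = (\<lambda>_ _. 0)" by (intro ext) (simp add: Y_zero_left)
  then show ?case using dominated_zero[OF g] by simp
next
  case (step c x y)
  have "Y (smul c x + y) = (\<lambda>m b. smul c (Y x m b) + Y y m b)"
    by (intro ext) (simp add: Y_add_left Y_scale_left)
  then show ?case using step dominated_add[OF g dominated_smul[OF g]] by auto
qed

text \<open>By linearity \<open>u\<close> may be replaced by a homogeneous component, which lies in
  \<open>U\<close> and so has polynomial bounds, and \<open>x\<close> by a spanning vector; the
  iterate estimate then keeps the growth function \<open>g\<close>.\<close>

lemma bounded_span_submodule:
  assumes g: "growth g" and U: "unitary_subalgebra smul Y vac cv star U"
    and E: "\<forall>a\<in>U. energy_bounds smul Y cv sp a"
    and u: "u \<in> U" and x: "x \<in> bounded_span g"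
  shows "Y u m x \<in> bounded_span g"
proof -
  have hom: "Y (cmp d u) m x \<in> bounded_span g" for d
    using x unfolding bounded_span_def
  proof (induction rule: span_induct_alt)
    case base
    show ?case by (simp add: Y_zero span_zero)
  next
    case (step c x y)
    then obtain e where x: "x \<in> Gz e" "dominated g (Y x)" by blast
    have uG: "cmp d u \<in> Gz (int d)" by (rule comp_decomposition)
    have "Y (cmp d u) = (\<lambda>m. pm (cmp d u) (m + (1 - int d)))"
      by (intro ext) (simp add: pmode_homogeneous[OF uG])
    moreover have "dominated (\<lambda>_. 1) (pm (cmp d u))"
      using E comp_in_subalgebra[OF U u] energy_bounds_imp_dom by blast
    ultimately have "dominated (\<lambda>_. 1) (Y (cmp d u))" using dominated_shift[OF growth_one] by simp
    then have "dominated g (Y (Y (cmp d u) m x))" by (rule dominated_iterate[OF g uG _ x])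
    moreover have "Y (cmp d u) m x \<in> Gz (e + int d - m - 1)" by (rule Y_grade[OF uG x(1) refl])
    ultimately have "Y (cmp d u) m x \<in> span {x. \<exists>d. x \<in> Gz d \<and> dominated g (Y x)}"
      by (intro span_base) blast
    then show ?case unfolding Y_add Y_scale using step by (intro span_add span_scale)
  qed
  have "Y u m x = (\<Sum>d | cmp d u \<noteq> 0. Y (cmp d u) m x)"
    by (subst comp_decomposition(3)) (rule Y_sum_left)
  then show ?thesis using hom unfolding bounded_span_def by (simp add: span_sum)
qed

text \<open>A nonzero vector is chosen in each simple summand, and the finite set collects the
  vectors controlling their components. For admissible \<open>g\<close>, the bounded span for
  \<open>sqrt g\<close> is stable under \<open>U\<close> and meets each summand nontrivially, so by
  simplicity it contains the summand.\<close>

lemma zero_modes_control_all: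
  assumes U: "unitary_subalgebra smul Y vac cv star U"
    and E: "\<forall>a\<in>U. energy_bounds smul Y cv sp a"
    and fin: "finite_sum_simple_U_modules smul Y U"
  shows "\<exists>F. finite F \<and> (\<forall>g. growth g \<longrightarrow> (\<forall>w\<in>F. dominated g (\<lambda>_. pm w 0)) \<longrightarrow> (\<forall>a. dominated (\<lambda>n. sqrt (g n)) (Y a)))"
proof -
  obtain k :: nat and M where M: "\<And>i. i < k \<Longrightarrow> simple_U_submodule smul Y U (M i)"
    and dec: "\<forall>v. \<exists>!x::nat \<Rightarrow> 'v. (\<forall>i<k. x i \<in> M i) \<and> (\<forall>i\<ge>k. x i = 0) \<and> v = (\<Sum>i<k. x i)"
    using fin unfolding finite_sum_simple_U_modules_def by blast
  have "\<forall>i. \<exists>s. i < k \<longrightarrow> s \<in> M i \<and> s \<noteq> 0"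
  proof (intro allI)
    fix i
    have "\<exists>s. s \<in> M i \<and> s \<noteq> 0" if "i < k"
    proof (rule ccontr)
      assume "\<nexists>s. s \<in> M i \<and> s \<noteq> 0"
      then have "M i \<subseteq> {0}" by auto
      moreover have "0 \<in> M i" "M i \<noteq> {0}"
        using M[OF that] subspace_0 by (auto simp: simple_U_submodule_def U_submodule_def)
      ultimately show False by auto
    qed
    then show "\<exists>s. i < k \<longrightarrow> s \<in> M i \<and> s \<noteq> 0" by (cases "i < k") auto
  qed
  then obtain s where s: "\<And>i. i < k \<Longrightarrow> s i \<in> M i \<and> s i \<noteq> 0" by metis
  define P where "P = (SIGMA i:{..<k}. {d. cmp d (s i) \<noteq> 0})"
  have P: "finite P" unfolding P_def using comp_decomposition(1) by auto
  have "\<forall>p. \<exists>F. finite F \<and> (\<forall>g. growth g \<longrightarrow> (\<forall>w\<in>F. dominated g (\<lambda>_. pm w 0)) \<longrightarrow>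
      dominated (\<lambda>n. sqrt (g n)) (Y (cmp (snd p) (s (fst p)))))"
    by (intro allI, rule dominated_all_modes, rule comp_decomposition(2))
  then obtain F where F: "\<forall>p. finite (F p) \<and> (\<forall>g. growth g \<longrightarrow> (\<forall>w\<in>F p. dominated g (\<lambda>_. pm w 0)) \<longrightarrow>
      dominated (\<lambda>n. sqrt (g n)) (Y (cmp (snd p) (s (fst p)))))"
    by (elim choice[THEN exE]) (rule that)
  show ?thesis
  proof (intro exI[of _ "\<Union>p\<in>P. F p"] conjI allI impI)
    fix g a assume g: "growth g" and Fg: "\<forall>w\<in>(\<Union>p\<in>P. F p). dominated g (\<lambda>_. pm w 0)"
    define h where "h n = sqrt (g n)" for n
    have h: "growth h" unfolding h_def by (rule growth_sqrt[OF g])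
    let ?N = "bounded_span h"
    have N: "subspace ?N" unfolding bounded_span_def by simp
    have MN: "M i \<subseteq> ?N" if i: "i < k" for i
    proof -
      \<comment> \<open>\<open>M i\<close> is not assumed to be graded, so the components are placed
        in the span one by one, and only their sum \<open>s i\<close> is compared with
        \<open>M i\<close>.\<close>
      have "cmp d (s i) \<in> ?N" if "cmp d (s i) \<noteq> 0" for d
      proof -
        have "(i, d) \<in> P" using that i by (simp add: P_def)
        then have "dominated h (Y (cmp d (s i)))"
          unfolding h_def using F[rule_format, of "(i, d)"] g Fg by auto
        then show ?thesis unfolding bounded_span_def
          using comp_decomposition(2)[of d "s i"] by (intro span_base) blast
      qed
      then have "(\<Sum>d | cmp d (s i) \<noteq> 0. cmp d (s i)) \<in> ?N"
        by (intro subspace_sum[OF N]) simp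
      then have sN: "s i \<in> ?N" using comp_decomposition(3)[of "s i"] by simp
      have "U_submodule smul Y U (M i \<inter> ?N)"
        unfolding U_submodule_def
      proof (intro conjI ballI allI)
        show "subspace (M i \<inter> ?N)"
          using M[OF i] N subspace_inter by (simp add: simple_U_submodule_def U_submodule_def)
        fix u x m assume "u \<in> U" "x \<in> M i \<inter> ?N"
        then show "Y u m x \<in> M i \<inter> ?N"
          using M[OF i] bounded_span_submodule[OF h U E]
          by (simp add: simple_U_submodule_def U_submodule_def)
      qed
      then have "M i \<inter> ?N = {0} \<or> M i \<inter> ?N = M i"
        using M[OF i] unfolding simple_U_submodule_def by blast
      then show ?thesis using s[OF i] sN by blast
    qed
    obtain x where "\<forall>i<k. x i \<in> M i" "a = (\<Sum>i<k. x i)" using dec by blast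
    then have "a \<in> ?N" using MN by (auto intro!: subspace_sum[OF N])
    then show "dominated (\<lambda>n. sqrt (g n)) (Y a)"
      using bounded_span_dom[OF h] unfolding h_def by blast
  qed (use P F in auto)
qed

text \<open>The controlling zero modes obey the very estimate they control: taking for
  \<open>g\<close> their maximal norm up to degree \<open>n\<close> closes the loop and yields the
  self-improving inequality.\<close>

lemma extension_energy_bounded:
  assumes exp: "exp_energy_bounded smul Y cv sp"
    and U: "unitary_subalgebra smul Y vac cv star U"
    and E: "\<forall>a\<in>U. energy_bounds smul Y cv sp a"
    and fin: "finite_sum_simple_U_modules smul Y U"
  shows "energy_bounds smul Y cv sp a"
proof -
  obtain F where F: "finite F" and control: "\<forall>g. growth g \<longrightarrow> (\<forall>w\<in>F. dominated g (\<lambda>_. pm w 0)) \<longrightarrow>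
      (\<forall>a. dominated (\<lambda>n. sqrt (g n)) (Y a))"
    using zero_modes_control_all[OF U E fin] by (elim exE conjE) (rule that)
  have "\<forall>w. \<exists>K R. K \<ge> 0 \<and> R \<ge> 1 \<and> (\<forall>n. \<forall>c\<in>Gz (int n). nrm (pm w 0 c) \<le> K * R ^ n * nrm c)"
    using exp_energy_bounded_zero_mode[OF exp] by metis
  then obtain K R where KR: "\<And>w. K w \<ge> 0" "\<And>w. R w \<ge> 1"
    "\<And>w n c. c \<in> Gz (int n) \<Longrightarrow> nrm (pm w 0 c) \<le> K w * R w ^ n * nrm c"
    by metis
  \<comment> \<open>Sums over \<open>F\<close> serve as common upper bounds; the extra
    \<open>1\<close> gives \<open>R' \<ge> 1\<close> also for empty \<open>F\<close>.\<close>
  define K' R' where "K' = (\<Sum>w\<in>F. K w)" and "R' = 1 + (\<Sum>w\<in>F. R w)"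
  have K': "K' \<ge> 0" "w \<in> F \<Longrightarrow> K w \<le> K'" for w
    unfolding K'_def using KR F by (auto intro: sum_nonneg member_le_sum)
  have R0: "R w \<ge> 0" for w using KR(2)[of w] by simp
  have R': "R' \<ge> 1" "w \<in> F \<Longrightarrow> R w \<le> R'" for w
  proof -
    show "R' \<ge> 1" unfolding R'_def using R0 by (simp add: sum_nonneg)
    show "w \<in> F \<Longrightarrow> R w \<le> R'" unfolding R'_def
      using member_le_sum[of w F R] R0 F by fastforce
  qed
  \<comment> \<open>The element \<open>0\<close> keeps the set nonempty when \<open>F\<close> is
    empty; admitting all degrees up to \<open>n\<close> makes the supremum monotone.\<close>
  define A where "A n = insert 0 (\<Union>i\<in>{..n}. {nrm (pm w 0 c) | w c. w \<in> F \<and> c \<in> Gz (int i) \<and> nrm c \<le> 1})" for n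
  have A_le: "x \<le> K' * R' ^ n" if x: "x \<in> A n" for x n
  proof (cases "x = 0")
    case True
    then show ?thesis using K' R' by simp
  next
    case False
    with x obtain w i c where w: "x = nrm (pm w 0 c)" "w \<in> F" "i \<le> n" "c \<in> Gz (int i)" "nrm c \<le> 1"
      unfolding A_def by auto
    have "x \<le> K w * R w ^ i * nrm c" using KR(3) w by simp
    also have "\<dots> \<le> K' * R' ^ n * 1"
    proof (intro mult_mono)
      have "R w ^ i \<le> R' ^ i" by (intro power_mono R' R0 w)
      also have "\<dots> \<le> R' ^ n" by (intro power_increasing R' w)
      finally show "R w ^ i \<le> R' ^ n" .
    qed (use K' R' R0 KR w in auto)
    finally show ?thesis by simp
  qed
  have bdd: "bdd_above (A n)" for n by (rule bdd_aboveI[of _ "K' * R' ^ n"]) (rule A_le)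
  have A_ne: "A n \<noteq> {}" for n by (simp add: A_def)
  \<comment> \<open>The summand \<open>1\<close> gives the lower bound demanded by
    \<open>growth\<close>. The supremum is finite by the exponential bounds.\<close>
  define Z where "Z n = 1 + Sup (A n)" for n
  have Sup0: "Sup (A n) \<ge> 0" for n by (rule cSup_upper[OF _ bdd]) (simp add: A_def)
  have Z: "growth Z"
    unfolding growth_def mono_def
  proof (intro conjI allI impI)
    fix i j :: nat assume "i \<le> j"
    then have "A i \<subseteq> A j"
      unfolding A_def by (intro insert_mono UN_mono) auto
    then show "Z i \<le> Z j" unfolding Z_def using cSup_subset_mono[OF A_ne bdd] by simp
  qed (use Sup0 in \<open>simp add: Z_def\<close>)
  have dominatedZ: "dominated Z (\<lambda>_. pm w 0)" if w: "w \<in> F" for w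
  proof (rule dominatedI_nat[of 1])
    fix m :: int and n c assume c: "c \<in> Gz (int n)"
    have "nrm (pm w 0 c) \<le> Z n * nrm c"
    proof (rule nrm_le_by_scaling[where W = "Gz (int n)"])
      show "smul x c \<in> Gz (int n)" for x using c subspace_scale[OF subspace_Gz] by blast
      fix b assume "b \<in> Gz (int n)" "nrm b \<le> 1"
      then have "nrm (pm w 0 b) \<in> A n" using w unfolding A_def by blast
      then show "nrm (pm w 0 b) \<le> Z n" using cSup_upper[OF _ bdd] unfolding Z_def by fastforce
    qed (rule pmode_hom)
    then show "nrm (pm w 0 c) \<le> 1 * (1 + \<bar>of_int m\<bar> + real n) ^ 0 * Z (n + 0) * nrm c" by simp
  qed (auto simp: pmode_hom)
  have sqrtZ: "growth (\<lambda>n. sqrt (Z n))" by (rule growth_sqrt[OF Z])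
  have all: "dominated (\<lambda>n. sqrt (Z n)) (pm w)" for w
    using control Z dominatedZ by (intro dominated_pmode[OF sqrtZ]) blast
  \<comment> \<open>One set of constants for all of \<open>F\<close> is needed to pass to the
    supremum.\<close>
  have "\<exists>C s c0. C \<ge> 0 \<and> (\<forall>w\<in>F. \<forall>m k. \<forall>c\<in>Gz k.
     nrm (pm w m c) \<le> C * (1 + \<bar>of_int m\<bar> + \<bar>of_int k\<bar>) ^ s * sqrt (Z (nat k + c0)) * nrm c)"
    by (rule dominated_uniform[OF sqrtZ F all])
  then obtain C s c0 where C: "C \<ge> 0" "\<forall>w\<in>F. \<forall>m k. \<forall>c\<in>Gz k.
     nrm (pm w m c) \<le> C * (1 + \<bar>of_int m\<bar> + \<bar>of_int k\<bar>) ^ s * sqrt (Z (nat k + c0)) * nrm c"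
    by (elim exE conjE) (rule that)
  have sq1: "sqrt (Z n) \<ge> 1" for n using growth_ge1[OF sqrtZ] .
  \<comment> \<open>At mode \<open>0\<close> the bound for \<open>F\<close> is a bound for
    \<open>Z\<close> itself; the summand \<open>1\<close> in \<open>Z\<close> is absorbed by
    \<open>C + 1\<close>.\<close>
  have improve: "Z n \<le> (C + 1) * (1 + real n) ^ s * sqrt (Z (n + c0))" for n
  proof -
    let ?B = "(1 + real n) ^ s * sqrt (Z (n + c0))"
    have "Sup (A n) \<le> C * ?B"
    proof (rule cSup_least[OF A_ne])
      fix x assume x: "x \<in> A n"
      show "x \<le> C * ?B"
      proof (cases "x = 0")
        case True
        then show ?thesis using C(1) growth_ge0[OF Z] by simp
      next
        case False
        with x obtain w i c where w: "x = nrm (pm w 0 c)" "w \<in> F" "i \<le> n" "c \<in> Gz (int i)" "nrm c \<le> 1"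
          unfolding A_def by auto
        have "x \<le> C * (1 + \<bar>of_int 0\<bar> + \<bar>of_int (int i)\<bar>) ^ s * sqrt (Z (nat (int i) + c0)) * nrm c"
          unfolding w(1) by (rule C(2)[rule_format, OF w(2,4)])
        also have "\<dots> \<le> C * (1 + real n) ^ s * sqrt (Z (n + c0)) * nrm c"
          by (rule dominated_weaken[OF sqrtZ]) (use C(1) w in auto)
        also have "\<dots> \<le> C * (1 + real n) ^ s * sqrt (Z (n + c0)) * 1"
          using C(1) growth_ge0[OF Z] by (intro mult_left_mono w) auto
        finally show ?thesis by (simp add: mult_ac)
      qed
    qed
    moreover have "1 \<le> ?B" using sq1[of "n + c0"] mult_mono[of 1 "(1 + real n) ^ s" 1] by simp
    ultimately show ?thesis unfolding Z_def[of n] by (simp add: algebra_simps)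
  qed
  have "Z n \<le> (K' + 1) * R' ^ n" for n
  proof -
    have "Sup (A n) \<le> K' * R' ^ n" by (rule cSup_least[OF A_ne A_le])
    then show ?thesis using one_le_power[OF R'(1), of n] unfolding Z_def by (simp add: algebra_simps)
  qed
  then obtain C' s' where Zpoly: "C' \<ge> 0" "\<And>n. Z n \<le> C' * (1 + real n) ^ s'"
    using self_improving_bound[OF growth_ge1[OF Z] _ improve _ R'(1)] C(1) by fastforce
  have "dominated (\<lambda>_. 1) (pm a)"
  proof -
    obtain D p d0 where D: "D \<ge> 0" "\<And>m k c. c \<in> Gz k \<Longrightarrow>
       nrm (pm a m c) \<le> D * (1 + \<bar>of_int m\<bar> + \<bar>of_int k\<bar>) ^ p * sqrt (Z (nat k + d0)) * nrm c"
      using all[of a] unfolding dominated_def by blast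
    show ?thesis
    proof (rule dominatedI_nat[of "D * (C' * (1 + real d0) ^ s')"])
      fix m n c assume c: "c \<in> Gz (int n)"
      let ?X = "1 + \<bar>of_int m\<bar> + real n"
      \<comment> \<open>Any polynomial bound suffices here, so the square root is simply dropped,
        using \<open>Z \<ge> 1\<close>.\<close>
      have "sqrt (Z (n + d0)) \<le> Z (n + d0)" using sq1[of "n + d0"] growth_ge1[OF Z, of "n + d0"]
        by (metis mult_left_mono mult.right_neutral order_trans real_sqrt_ge_zero real_sqrt_mult_self abs_of_nonneg zero_le_one)
      also have "\<dots> \<le> C' * (1 + real (n + d0)) ^ s'" by (rule Zpoly)
      also have "\<dots> \<le> C' * ((1 + real d0) * ?X) ^ s'"
      proof (intro mult_left_mono power_mono Zpoly(1))
        have "real d0 * 1 \<le> real d0 * ?X" by (intro mult_left_mono) auto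
        then show "1 + real (n + d0) \<le> (1 + real d0) * ?X" by (simp add: algebra_simps)
      qed simp
      finally have Zle: "sqrt (Z (n + d0)) \<le> C' * (1 + real d0) ^ s' * ?X ^ s'"
        by (simp add: power_mult_distrib)
      have "nrm (pm a m c) \<le> D * ?X ^ p * sqrt (Z (n + d0)) * nrm c"
        using D(2)[OF c] by simp
      also have "\<dots> \<le> D * ?X ^ p * (C' * (1 + real d0) ^ s' * ?X ^ s') * nrm c"
        using D(1) by (intro mult_right_mono mult_left_mono Zle) auto
      finally show "nrm (pm a m c) \<le> D * (C' * (1 + real d0) ^ s') * ?X ^ (p + s') * 1 * nrm c"
        by (simp add: power_add mult_ac)
    qed (use D(1) Zpoly(1) in \<open>auto simp: pmode_hom\<close>)
  qed
  then show ?thesis by (rule dominated_imp_energy_bounds)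
qed

end

theorem mainTheorem11:
  fixes smul :: "complex \<Rightarrow> 'v::ab_group_add \<Rightarrow> 'v"
    and Y :: "'v \<Rightarrow> int \<Rightarrow> 'v \<Rightarrow> 'v"
    and vac cv :: 'v
    and sp :: "'v \<Rightarrow> 'v \<Rightarrow> complex"
    and star :: "'v \<Rightarrow> 'v"
    and U :: "'v set"
  assumes "simple_unitary_VOA smul Y vac cv sp star"
    and "exp_energy_bounded smul Y cv sp"
    and "unitary_subalgebra smul Y vac cv star U"
    and "\<forall>a\<in>U. energy_bounds smul Y cv sp a"
    and "finite_sum_simple_U_modules smul Y U"
  shows "\<forall>a. energy_bounds smul Y cv sp a"
proof -
  interpret uVOA smul Y vac cv sp star
    using assms(1) by unfold_locales (simp add: simple_unitary_VOA_def)
  show ?thesis using extension_energy_bounded[OF assms(2-5)] by blast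
qed

end
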